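(* The Schwarzschild and Kerr solutions obey the new boundary conditions at spatial infinity (recalled in the context) after a redefinition of the radial coordinate. Precisely: (i) for the slice $t=\text{const}$ of the Schwarzschild solution of mass $m$ in Schwarzschild coordinates, the data $(g_{ij},\pi^{ij})$ expressed in terms of $r'=r(1+\frac mr)$ obey the new boundary conditions, with $\bar k_{AB}=0$; (ii) for the slice $t=\text{const}$ of the Kerr solution of mass $m$ in Boyer–Lindquist coordinates, the data expressed in terms of the same $r'=r(1+\frac mr)$ obey the new boundary conditions, with $\bar\pi^{r\varphi}=0$.
   Context: Units are $G=c=1$. $g_{ij}$ is the induced metric on the slice and $\pi^{ij}$ its conjugate ADM momentum (proportional to $\sqrt g(K^{ij}-g^{ij}K)$, with $K_{ij}$ the extrinsic curvature of the slice), a symmetric tensor density of weight one. Only the region near infinity matters. $\bar\gamma_{AB}$ is the unit round metric on the sphere with coordinates $x^A=(\theta,\varphi)$. Barred quantities and quantities with superscript $(2)$ are fields on the sphere, with indices moved with $\bar\gamma$. Below $r$ stands for the radial coordinate used (here $r'$). **New boundary conditions.** (1) Fall-off as $r\to\infty$: $g_{rr}=1+\frac1r\bar h_{rr}+\frac1{r^2}h^{(2)}_{rr}+o(r^{-2})$, $g_{rA}=\frac1rh^{(2)}_{rA}+o(r^{-1})$, $g_{AB}=r^2\bar\gamma_{AB}+r\bar h_{AB}+h^{(2)}_{AB}+o(1)$, $\pi^{rr}=\bar\pi^{rr}+\frac1r\pi^{(2)rr}+o(r^{-1})$, $\pi^{rA}=\frac1r\bar\pi^{rA}+\frac1{r^2}\pi^{(2)rA}+o(r^{-2})$,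 $\pi^{AB}=\frac1{r^2}\bar\pi^{AB}+\frac1{r^3}\pi^{(2)AB}+o(r^{-3})$. (2) Constraint fall-off: $\mathcal H=o(r^{-1})$, $\mathcal H_r=o(r^{-1})$, $\mathcal H_A=o(1)$, where $\mathcal H=-\sqrt g\,R+\frac1{\sqrt g}(\pi^{ij}\pi_{ij}-\frac12\pi^2)$, $\mathcal H_i=-2\pi_i{}^j{}_{|j}$ ($|$: covariant derivative of $g$, $R$ its scalar curvature, $\pi=g_{ij}\pi^{ij}$; $\pi^{ij}$ normalized accordingly). (3) Parity: with $\bar\lambda=\frac12\bar h_{rr}$, $\bar k_{AB}=\frac12\bar h_{AB}+\bar\lambda\bar\gamma_{AB}$, $\bar p=2(\bar\pi^{rr}-\bar\pi^A{}_A)$, one requires, under the antipodal map $\theta\to\pi-\theta$, $\varphi\to\varphi+\pi$, that the components $\bar\lambda,\bar\pi^{r\varphi},\bar\pi^{\theta\theta},\bar\pi^{\varphi\varphi},\bar k_{\theta\varphi}$ be even and $\bar p,\bar\pi^{r\theta},\bar\pi^{\theta\varphi},\bar k_{\theta\theta},\bar k_{\varphi\varphi}$ be odd. *)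

theory Defs
  imports "HOL-Analysis.Analysis"
begin

section \<open>Tensor calculus in a coordinate chart\<close>

text \<open>
  A field of square matrices on the coordinate space \<open>real ^ 'n\<close> holds the components of a
  2-tensor: \<open>g x $ i $ j\<close> is \<open>g\<^sub>i\<^sub>j\<close> at the point with coordinates \<open>x\<close>.
\<close>

definition partial :: "'n \<Rightarrow> (real ^ 'n \<Rightarrow> real) \<Rightarrow> real ^ ('n::finite) \<Rightarrow> real" where
  "partial i f x = deriv (\<lambda>s. f (x + s *\<^sub>R axis i 1)) 0"

definition inv_metric :: "(real ^ 'n \<Rightarrow> real ^ 'n ^ 'n) \<Rightarrow> real ^ 'n \<Rightarrow> real ^ 'n ^ ('n::finite)" where
  "inv_metric g x = matrix_inv (g x)"

text \<open>\<open>christoffel g k i j\<close> has the upper index first: it is \<open>\<Gamma>\<close> with \<open>k\<close> up and \<open>i j\<close> down.\<close>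

definition christoffel ::
  "(real ^ 'n \<Rightarrow> real ^ 'n ^ 'n) \<Rightarrow> 'n \<Rightarrow> 'n \<Rightarrow> 'n \<Rightarrow> real ^ ('n::finite) \<Rightarrow> real" where
  "christoffel g k i j x =
     (1/2) * (\<Sum>l\<in>UNIV. inv_metric g x $ k $ l *
       (partial i (\<lambda>y. g y $ l $ j) x + partial j (\<lambda>y. g y $ l $ i) x
        - partial l (\<lambda>y. g y $ i $ j) x))"

definition ricci ::
  "(real ^ 'n \<Rightarrow> real ^ 'n ^ 'n) \<Rightarrow> 'n \<Rightarrow> 'n \<Rightarrow> real ^ ('n::finite) \<Rightarrow> real" where
  "ricci g i j x =
     (\<Sum>k\<in>UNIV. partial k (christoffel g k i j) x - partial j (christoffel g k i k) x
        + (\<Sum>l\<in>UNIV. christoffel g k k l x * christoffel g l i j x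
                    - christoffel g k j l x * christoffel g l i k x))"

definition scalar_curvature ::
  "(real ^ 'n \<Rightarrow> real ^ 'n ^ 'n) \<Rightarrow> real ^ ('n::finite) \<Rightarrow> real" where
  "scalar_curvature g x = (\<Sum>i\<in>UNIV. \<Sum>j\<in>UNIV. inv_metric g x $ i $ j * ricci g i j x)"

definition cov_deriv_covector ::
  "(real ^ 'n \<Rightarrow> real ^ 'n ^ 'n) \<Rightarrow> (real ^ 'n \<Rightarrow> real ^ 'n) \<Rightarrow> 'n \<Rightarrow> 'n \<Rightarrow> real ^ ('n::finite) \<Rightarrow> real"
  where
  "cov_deriv_covector g v i j x =
     partial i (\<lambda>y. v y $ j) x - (\<Sum>k\<in>UNIV. christoffel g k i j x * v x $ k)"

text \<open>
  Covariant derivative in direction \<open>k\<close> of a mixed tensor density of weight one;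
  \<open>T x $ i $ j\<close> has \<open>i\<close> down and \<open>j\<close> up. The last term is the weight-one correction.
\<close>

definition cov_deriv_mixed_density ::
  "(real ^ 'n \<Rightarrow> real ^ 'n ^ 'n) \<Rightarrow> (real ^ 'n \<Rightarrow> real ^ 'n ^ 'n) \<Rightarrow>
   'n \<Rightarrow> 'n \<Rightarrow> 'n \<Rightarrow> real ^ ('n::finite) \<Rightarrow> real" where
  "cov_deriv_mixed_density g T k i j x =
     partial k (\<lambda>y. T y $ i $ j) x
     - (\<Sum>l\<in>UNIV. christoffel g l k i x * T x $ l $ j)
     + (\<Sum>l\<in>UNIV. christoffel g j k l x * T x $ i $ l)
     - (\<Sum>l\<in>UNIV. christoffel g l k l x) * T x $ i $ j"

text \<open>
  Components in new coordinates, where \<open>y\<close> maps new coordinates to old ones, of a covariant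
  2-tensor and of a contravariant 2-tensor density of weight one.
\<close>

definition jacobian :: "(real ^ 'n \<Rightarrow> real ^ 'n) \<Rightarrow> real ^ 'n \<Rightarrow> real ^ 'n ^ ('n::finite)" where
  "jacobian y x = (\<chi> k i. partial i (\<lambda>z. y z $ k) x)"

definition transform_metric ::
  "(real ^ 'n \<Rightarrow> real ^ 'n) \<Rightarrow> (real ^ 'n \<Rightarrow> real ^ 'n ^ 'n) \<Rightarrow> real ^ 'n \<Rightarrow> real ^ 'n ^ ('n::finite)"
  where
  "transform_metric y g x = transpose (jacobian y x) ** g (y x) ** jacobian y x"

definition transform_momentum ::
  "(real ^ 'n \<Rightarrow> real ^ 'n) \<Rightarrow> (real ^ 'n \<Rightarrow> real ^ 'n ^ 'n) \<Rightarrow> real ^ 'n \<Rightarrow> real ^ 'n ^ ('n::finite)"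
  where
  "transform_momentum y P x =
     \<bar>det (jacobian y x)\<bar> *\<^sub>R
       (matrix_inv (jacobian y x) ** P (y x) ** transpose (matrix_inv (jacobian y x)))"

section \<open>Canonical data on a slice \<open>t = const\<close>\<close>

text \<open>
  Spacetime coordinates are \<open>(t, r, \<theta>, \<phi>)\<close>, numbered 1 to 4, with signature \<open>(-,+,+,+)\<close>;
  slice coordinates are \<open>(r, \<theta>, \<phi>)\<close>, numbered 1 to 3.
\<close>

definition spatial :: "3 \<Rightarrow> 4" where
  "spatial i = (if i = 1 then 2 else if i = 2 then 3 else 4)"

definition event :: "real \<Rightarrow> real ^ 3 \<Rightarrow> real ^ 4" where
  "event t x = vector [t, x $ 1, x $ 2, x $ 3]"

definition induced_metric :: "(real ^ 4 \<Rightarrow> real ^ 4 ^ 4) \<Rightarrow> real \<Rightarrow> real ^ 3 \<Rightarrow> real ^ 3 ^ 3" where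
  "induced_metric G t x = (\<chi> i j. G (event t x) $ spatial i $ spatial j)"

text \<open>The future-directed unit normal of the foliation by \<open>t\<close>, as a covector.\<close>

definition unit_normal :: "(real ^ 4 \<Rightarrow> real ^ 4 ^ 4) \<Rightarrow> real ^ 4 \<Rightarrow> real ^ 4" where
  "unit_normal G X = (- 1 / sqrt (- (inv_metric G X $ 1 $ 1))) *\<^sub>R axis 1 1"

text \<open>
  Sign convention: \<open>K\<close> is half the Lie derivative of the metric along the future unit normal,
  so that the momentum conjugate to \<open>g\<close> is \<open>+ sqrt g (K\<^sup>i\<^sup>j - g\<^sup>i\<^sup>j K)\<close>.
\<close>

definition extrinsic_curvature ::
  "(real ^ 4 \<Rightarrow> real ^ 4 ^ 4) \<Rightarrow> real \<Rightarrow> real ^ 3 \<Rightarrow> real ^ 3 ^ 3" where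
  "extrinsic_curvature G t x =
     (\<chi> i j. cov_deriv_covector G (unit_normal G) (spatial i) (spatial j) (event t x))"

definition adm_momentum :: "(real ^ 4 \<Rightarrow> real ^ 4 ^ 4) \<Rightarrow> real \<Rightarrow> real ^ 3 \<Rightarrow> real ^ 3 ^ 3" where
  "adm_momentum G t x =
     (let g = induced_metric G t;
          h = inv_metric g x;
          K = extrinsic_curvature G t x;
          trK = (\<Sum>i\<in>UNIV. \<Sum>j\<in>UNIV. h $ i $ j * K $ i $ j)
      in sqrt (det (g x)) *\<^sub>R (h ** K ** h - trK *\<^sub>R h))"

section \<open>Constraints\<close>

text \<open>\<open>lower_first g P\<close> is \<open>g\<^sub>i\<^sub>k P\<^sup>k\<^sup>j\<close>, \<open>lower_both g P\<close> is \<open>g\<^sub>i\<^sub>k g\<^sub>j\<^sub>l P\<^sup>k\<^sup>l\<close>.\<close>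

definition lower_first ::
  "(real ^ 3 \<Rightarrow> real ^ 3 ^ 3) \<Rightarrow> (real ^ 3 \<Rightarrow> real ^ 3 ^ 3) \<Rightarrow> real ^ 3 \<Rightarrow> real ^ 3 ^ 3" where
  "lower_first g P x = g x ** P x"

definition lower_both ::
  "(real ^ 3 \<Rightarrow> real ^ 3 ^ 3) \<Rightarrow> (real ^ 3 \<Rightarrow> real ^ 3 ^ 3) \<Rightarrow> real ^ 3 \<Rightarrow> real ^ 3 ^ 3" where
  "lower_both g P x = g x ** P x ** transpose (g x)"

definition hamiltonian_constraint ::
  "(real ^ 3 \<Rightarrow> real ^ 3 ^ 3) \<Rightarrow> (real ^ 3 \<Rightarrow> real ^ 3 ^ 3) \<Rightarrow> real ^ 3 \<Rightarrow> real" where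
  "hamiltonian_constraint g P x =
     - sqrt (det (g x)) * scalar_curvature g x
     + 1 / sqrt (det (g x)) *
       ((\<Sum>i\<in>UNIV. \<Sum>j\<in>UNIV. P x $ i $ j * lower_both g P x $ i $ j)
        - (1/2) * (\<Sum>i\<in>UNIV. \<Sum>j\<in>UNIV. g x $ i $ j * P x $ i $ j)\<^sup>2)"

definition momentum_constraint ::
  "(real ^ 3 \<Rightarrow> real ^ 3 ^ 3) \<Rightarrow> (real ^ 3 \<Rightarrow> real ^ 3 ^ 3) \<Rightarrow> 3 \<Rightarrow> real ^ 3 \<Rightarrow> real" where
  "momentum_constraint g P i x =
     - 2 * (\<Sum>j\<in>UNIV. cov_deriv_mixed_density g (lower_first g P) j i j x)"

section \<open>The boundary conditions\<close>

text \<open>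
  Fields on the sphere are given by components in the chart \<open>0 < \<theta> < \<pi>\<close>, with \<open>\<phi>\<close> ranging
  over the reals; angular indices \<open>A\<close> are of type 2, with 1 for \<open>\<theta>\<close> and 2 for \<open>\<phi>\<close>.
\<close>

type_synonym sphere_field = "real \<Rightarrow> real \<Rightarrow> real"

definition sphere_chart :: "(real \<times> real) set" where
  "sphere_chart = {0<..<pi} \<times> UNIV"

definition ang :: "2 \<Rightarrow> 3" where
  "ang A = (if A = 1 then 2 else 3)"

definition round_metric :: "2 \<Rightarrow> 2 \<Rightarrow> sphere_field" where
  "round_metric A B \<theta> \<phi> = (if A = B then (if A = 1 then 1 else (sin \<theta>)\<^sup>2) else 0)"

definition periodic :: "sphere_field \<Rightarrow> bool" where
  "periodic f \<longleftrightarrow> (\<forall>(\<theta>, \<phi>) \<in> sphere_chart. f \<theta> (\<phi> + 2 * pi) = f \<theta> \<phi>)"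

definition parity_even :: "sphere_field \<Rightarrow> bool" where
  "parity_even f \<longleftrightarrow> (\<forall>(\<theta>, \<phi>) \<in> sphere_chart. f (pi - \<theta>) (\<phi> + pi) = f \<theta> \<phi>)"

definition parity_odd :: "sphere_field \<Rightarrow> bool" where
  "parity_odd f \<longleftrightarrow> (\<forall>(\<theta>, \<phi>) \<in> sphere_chart. f (pi - \<theta>) (\<phi> + pi) = - f \<theta> \<phi>)"

definition vanishes_on_sphere :: "sphere_field \<Rightarrow> bool" where
  "vanishes_on_sphere f \<longleftrightarrow> (\<forall>(\<theta>, \<phi>) \<in> sphere_chart. f \<theta> \<phi> = 0)"

text \<open>
  \<open>unif_o k F\<close>: \<open>F\<close> is \<open>o(r\<^sup>-\<^sup>k)\<close> as \<open>r\<close> tends to infinity, uniformly over the sphere.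
  Coordinate components degenerate at the poles, so uniformity is asked of the components in the
  unit frame \<open>\<partial>\<^sub>\<theta>\<close>, \<open>\<partial>\<^sub>\<phi> / sin \<theta>\<close>, and densities are divided by the density \<open>sin \<theta>\<close> of
  the round sphere. \<open>frame A \<theta>\<close> is the round length of the coordinate vector \<open>\<partial>\<^sub>A\<close>.
  At each fixed angle this says that the coordinate component itself is \<open>o(r\<^sup>-\<^sup>k)\<close>.
\<close>

definition unif_o :: "nat \<Rightarrow> (real \<Rightarrow> sphere_field) \<Rightarrow> bool" where
  "unif_o k F \<longleftrightarrow>
     uniform_limit sphere_chart (\<lambda>r (\<theta>, \<phi>). r ^ k * F r \<theta> \<phi>) (\<lambda>_. 0) at_top"

definition frame :: "2 \<Rightarrow> real \<Rightarrow> real" where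
  "frame A \<theta> = (if A = 1 then 1 else sin \<theta>)"

definition pt :: "real \<Rightarrow> real \<Rightarrow> real \<Rightarrow> real ^ 3" where
  "pt r \<theta> \<phi> = vector [r, \<theta>, \<phi>]"

text \<open>
  Coefficients of the asymptotic expansions: \<open>h1\<close> and \<open>p1\<close> are the barred ones, \<open>h2\<close> and \<open>p2\<close>
  those with superscript (2).
\<close>

record bc_coeffs =
  h1_rr :: sphere_field
  h2_rr :: sphere_field
  h2_rA :: "2 \<Rightarrow> sphere_field"
  h1_AB :: "2 \<Rightarrow> 2 \<Rightarrow> sphere_field"
  h2_AB :: "2 \<Rightarrow> 2 \<Rightarrow> sphere_field"
  p1_rr :: sphere_field
  p2_rr :: sphere_field
  p1_rA :: "2 \<Rightarrow> sphere_field"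
  p2_rA :: "2 \<Rightarrow> sphere_field"
  p1_AB :: "2 \<Rightarrow> 2 \<Rightarrow> sphere_field"
  p2_AB :: "2 \<Rightarrow> 2 \<Rightarrow> sphere_field"

definition coeffs_on_sphere :: "bc_coeffs \<Rightarrow> bool" where
  "coeffs_on_sphere c \<longleftrightarrow>
     periodic (h1_rr c) \<and> periodic (h2_rr c) \<and> periodic (p1_rr c) \<and> periodic (p2_rr c) \<and>
     (\<forall>A. periodic (h2_rA c A) \<and> periodic (p1_rA c A) \<and> periodic (p2_rA c A)) \<and>
     (\<forall>A B. periodic (h1_AB c A B) \<and> periodic (h2_AB c A B) \<and>
            periodic (p1_AB c A B) \<and> periodic (p2_AB c A B))"

definition metric_falloff :: "bc_coeffs \<Rightarrow> (real ^ 3 \<Rightarrow> real ^ 3 ^ 3) \<Rightarrow> bool" where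
  "metric_falloff c g \<longleftrightarrow>
     unif_o 2 (\<lambda>r \<theta> \<phi>. g (pt r \<theta> \<phi>) $ 1 $ 1 - (1 + h1_rr c \<theta> \<phi> / r + h2_rr c \<theta> \<phi> / r\<^sup>2)) \<and>
     (\<forall>A. unif_o 1 (\<lambda>r \<theta> \<phi>.
        (g (pt r \<theta> \<phi>) $ 1 $ ang A - h2_rA c A \<theta> \<phi> / r) / frame A \<theta>)) \<and>
     (\<forall>A B. unif_o 0 (\<lambda>r \<theta> \<phi>.
        (g (pt r \<theta> \<phi>) $ ang A $ ang B
          - (r\<^sup>2 * round_metric A B \<theta> \<phi> + r * h1_AB c A B \<theta> \<phi> + h2_AB c A B \<theta> \<phi>))
        / (frame A \<theta> * frame B \<theta>)))"

definition momentum_falloff :: "bc_coeffs \<Rightarrow> (real ^ 3 \<Rightarrow> real ^ 3 ^ 3) \<Rightarrow> bool" where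
  "momentum_falloff c P \<longleftrightarrow>
     unif_o 1 (\<lambda>r \<theta> \<phi>.
        (P (pt r \<theta> \<phi>) $ 1 $ 1 - (p1_rr c \<theta> \<phi> + p2_rr c \<theta> \<phi> / r)) / sin \<theta>) \<and>
     (\<forall>A. unif_o 2 (\<lambda>r \<theta> \<phi>.
        (P (pt r \<theta> \<phi>) $ 1 $ ang A - (p1_rA c A \<theta> \<phi> / r + p2_rA c A \<theta> \<phi> / r\<^sup>2))
        * frame A \<theta> / sin \<theta>)) \<and>
     (\<forall>A B. unif_o 3 (\<lambda>r \<theta> \<phi>.
        (P (pt r \<theta> \<phi>) $ ang A $ ang B
          - (p1_AB c A B \<theta> \<phi> / r\<^sup>2 + p2_AB c A B \<theta> \<phi> / r ^ 3))
        * (frame A \<theta> * frame B \<theta>) / sin \<theta>))"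

definition constraint_falloff ::
  "(real ^ 3 \<Rightarrow> real ^ 3 ^ 3) \<Rightarrow> (real ^ 3 \<Rightarrow> real ^ 3 ^ 3) \<Rightarrow> bool" where
  "constraint_falloff g P \<longleftrightarrow>
     unif_o 1 (\<lambda>r \<theta> \<phi>. hamiltonian_constraint g P (pt r \<theta> \<phi>) / sin \<theta>) \<and>
     unif_o 1 (\<lambda>r \<theta> \<phi>. momentum_constraint g P 1 (pt r \<theta> \<phi>) / sin \<theta>) \<and>
     (\<forall>A. unif_o 0 (\<lambda>r \<theta> \<phi>.
        momentum_constraint g P (ang A) (pt r \<theta> \<phi>) / (frame A \<theta> * sin \<theta>)))"

definition lambda_bar :: "bc_coeffs \<Rightarrow> sphere_field" where
  "lambda_bar c \<theta> \<phi> = h1_rr c \<theta> \<phi> / 2"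

definition k_bar :: "bc_coeffs \<Rightarrow> 2 \<Rightarrow> 2 \<Rightarrow> sphere_field" where
  "k_bar c A B \<theta> \<phi> = h1_AB c A B \<theta> \<phi> / 2 + lambda_bar c \<theta> \<phi> * round_metric A B \<theta> \<phi>"

definition p_bar :: "bc_coeffs \<Rightarrow> sphere_field" where
  "p_bar c \<theta> \<phi> =
     2 * (p1_rr c \<theta> \<phi> - (\<Sum>A\<in>UNIV. \<Sum>B\<in>UNIV. round_metric A B \<theta> \<phi> * p1_AB c A B \<theta> \<phi>))"

definition parity_conditions :: "bc_coeffs \<Rightarrow> bool" where
  "parity_conditions c \<longleftrightarrow>
     parity_even (lambda_bar c) \<and> parity_even (p1_rA c 2) \<and>
     parity_even (p1_AB c 1 1) \<and> parity_even (p1_AB c 2 2) \<and> parity_even (k_bar c 1 2) \<and>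
     parity_odd (p_bar c) \<and> parity_odd (p1_rA c 1) \<and> parity_odd (p1_AB c 1 2) \<and>
     parity_odd (k_bar c 1 1) \<and> parity_odd (k_bar c 2 2)"

definition new_boundary_conditions ::
  "bc_coeffs \<Rightarrow> (real ^ 3 \<Rightarrow> real ^ 3 ^ 3) \<Rightarrow> (real ^ 3 \<Rightarrow> real ^ 3 ^ 3) \<Rightarrow> bool" where
  "new_boundary_conditions c g P \<longleftrightarrow>
     coeffs_on_sphere c \<and> metric_falloff c g \<and> momentum_falloff c P \<and>
     constraint_falloff g P \<and> parity_conditions c"

section \<open>The Schwarzschild and Kerr solutions\<close>

definition schwarzschild :: "real \<Rightarrow> real ^ 4 \<Rightarrow> real ^ 4 ^ 4" where
  "schwarzschild m X =
     (let r = X $ 2; \<theta> = X $ 3 in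
      vector [vector [- (1 - 2 * m / r), 0, 0, 0],
              vector [0, 1 / (1 - 2 * m / r), 0, 0],
              vector [0, 0, r\<^sup>2, 0],
              vector [0, 0, 0, r\<^sup>2 * (sin \<theta>)\<^sup>2]])"

text \<open>Boyer--Lindquist coordinates; \<open>a\<close> is the angular momentum per unit mass.\<close>

definition kerr :: "real \<Rightarrow> real \<Rightarrow> real ^ 4 \<Rightarrow> real ^ 4 ^ 4" where
  "kerr m a X =
     (let r = X $ 2; \<theta> = X $ 3;
          S = r\<^sup>2 + a\<^sup>2 * (cos \<theta>)\<^sup>2;
          D = r\<^sup>2 - 2 * m * r + a\<^sup>2
      in
      vector [vector [- (1 - 2 * m * r / S), 0, 0, - (2 * m * a * r * (sin \<theta>)\<^sup>2 / S)],
              vector [0, S / D, 0, 0],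
              vector [0, 0, S, 0],
              vector [- (2 * m * a * r * (sin \<theta>)\<^sup>2 / S), 0, 0,
                      (r\<^sup>2 + a\<^sup>2 + 2 * m * a\<^sup>2 * r * (sin \<theta>)\<^sup>2 / S) * (sin \<theta>)\<^sup>2]])"

definition new_radius :: "real \<Rightarrow> real \<Rightarrow> real" where
  "new_radius m r = r * (1 + m / r)"

text \<open>The coordinate map from \<open>(r', \<theta>, \<phi>)\<close> back to \<open>(r, \<theta>, \<phi>)\<close>, where \<open>r > 0\<close>.\<close>

definition old_coords :: "real \<Rightarrow> real ^ 3 \<Rightarrow> real ^ 3" where
  "old_coords m x = vector [inv_into {0<..} (new_radius m) (x $ 1), x $ 2, x $ 3]"

end

theory Submission
  imports Defs
begin

text \<open>
  In Boyer--Lindquist coordinates the slice metric is diagonal and axisymmetric, and only the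
  components \<open>r\<phi>\<close> and \<open>\<theta>\<phi>\<close> of the momentum are nonzero. Since \<open>r' = r + m\<close> is a translation,
  the data in the new coordinates are those of the slice at \<open>r' - m\<close>. The constraints hold
  exactly for \<open>r' > 3 \<bar>m\<bar>\<close>: expressed through logarithmic derivatives of the metric components, the
  Hamiltonian constraint becomes a polynomial identity in \<open>r\<close>, \<open>m\<close>, \<open>a\<^sup>2\<close>, \<open>cos\<^sup>2 \<theta>\<close>. Every remainder
  in the fall-off conditions is, in the frame components, a function of \<open>1 / r'\<close> and \<open>\<theta>\<close> that is
  continuous up to \<open>1 / r' = 0\<close> and the poles, and vanishes at \<open>1 / r' = 0\<close>, so compactness gives
  uniformity over the sphere. Schwarzschild is the case \<open>a = 0\<close>.
\<close>

subsection \<open>Diagonal axisymmetric metrics\<close>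

text \<open>The shift by m serves the parity condition. In the Boyer-Lindquist radius the angular
  metric has no term of order r, so \<lambda>-bar = m would give k-bar equal to m times the round
  metric, which is even where oddness is required. Writing r = r' - m produces the term -2 m r'
  times the round metric, and k-bar vanishes. The momentum causes no such conflict: it comes from
  the gradient of the frame-dragging velocity 2 m a r / A, so its r\<phi> component starts only at
  order r^-2 and all leading coefficients are zero. The obstacle is the scalar curvature, whose
  direct expansion in S, D and A consists of unwieldy fractions. With half logarithmic derivatives
  as variables, differentiating a metric component returns a multiple of that component, and
  denominators are cleared only once, by A^2 S^2. A second obstacle is that division by zero and the
  choice inside \<open>inv_into\<close> spoil the closed formulas outside a region, so each
  derivative is computed from an equality valid near the point.\<close>

lemma partial_eqI:
  fixes F :: "real ^ 'n::finite \<Rightarrow> real"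
  assumes "open U" "x \<in> U" and eq: "\<And>y. y \<in> U \<Longrightarrow> F y = f y"
    and d: "((\<lambda>s. f (x + s *\<^sub>R axis i 1)) has_real_derivative d) (at 0)"
  shows "partial i F x = d"
proof -
  have "((\<lambda>s::real. x + s *\<^sub>R axis i 1) \<longlongrightarrow> x + 0 *\<^sub>R axis i 1) (nhds 0)"
    by (intro tendsto_intros filterlim_ident)
  then have "\<forall>\<^sub>F s in nhds (0::real). x + s *\<^sub>R axis i 1 \<in> U"
    using assms(1,2) by (auto dest: topological_tendstoD)
  then have "\<forall>\<^sub>F s in nhds (0::real). F (x + s *\<^sub>R axis i 1) = f (x + s *\<^sub>R axis i 1)"
    by eventually_elim (use eq in auto)
  then have "((\<lambda>s. F (x + s *\<^sub>R axis i 1)) has_real_derivative d) (at 0)"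
    using d by (subst DERIV_cong_ev[OF refl _ refl])
  then show ?thesis
    unfolding partial_def by (rule DERIV_imp_deriv)
qed

lemma partial_const_on:
  fixes F :: "real ^ 'n::finite \<Rightarrow> real"
  assumes "open U" "x \<in> U" "\<And>y. y \<in> U \<Longrightarrow> F y = k"
  shows "partial i F x = 0"
  by (rule partial_eqI[where f="\<lambda>_. k", OF assms]) auto

text \<open>Differentiating a closed formula needs it on a neighbourhood; an open \<open>U\<close>
  supplies one. In the three rules \<open>f\<close> takes only r and \<theta>, which is how
  axisymmetry enters.\<close>

locale open_set =
  fixes U :: "(real ^ 3) set"
  assumes open_U: "open U"
begin

lemma partial_1I:
  assumes "x \<in> U" "\<And>y. y \<in> U \<Longrightarrow> F y = f (y $ 1) (y $ 2)"
    "((\<lambda>r. f r (x $ 2)) has_real_derivative d) (at (x $ 1))"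
  shows "partial 1 F x = d"
proof (rule partial_eqI[OF open_U assms(1,2)])
  show "((\<lambda>s. f ((x + s *\<^sub>R axis 1 1) $ 1) ((x + s *\<^sub>R axis 1 1) $ 2))
      has_real_derivative d) (at 0)"
    using assms(3) DERIV_at_within_shift[of "\<lambda>r. f r (x $ 2)" d "x $ 1" 0 UNIV]
    by (simp add: axis_def)
qed

lemma partial_2I:
  assumes "x \<in> U" "\<And>y. y \<in> U \<Longrightarrow> F y = f (y $ 1) (y $ 2)"
    "((\<lambda>\<theta>. f (x $ 1) \<theta>) has_real_derivative d) (at (x $ 2))"
  shows "partial 2 F x = d"
proof (rule partial_eqI[OF open_U assms(1,2)])
  show "((\<lambda>s. f ((x + s *\<^sub>R axis 2 1) $ 1) ((x + s *\<^sub>R axis 2 1) $ 2))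
      has_real_derivative d) (at 0)"
    using assms(3) DERIV_at_within_shift[of "\<lambda>\<theta>. f (x $ 1) \<theta>" d "x $ 2" 0 UNIV]
    by (simp add: axis_def)
qed

lemma partial_3I:
  assumes "x \<in> U" "\<And>y. y \<in> U \<Longrightarrow> F y = f (y $ 1) (y $ 2)"
  shows "partial 3 F x = 0"
  by (rule partial_eqI[OF open_U assms]) (simp_all add: axis_def)

end

definition diag3 :: "real \<Rightarrow> real \<Rightarrow> real \<Rightarrow> real ^ 3 ^ 3" where
  "diag3 e f h = vector [vector [e, 0, 0], vector [0, f, 0], vector [0, 0, h]]"

lemma diag3_nth [simp]:
  "diag3 e f h $ 1 $ 1 = e" "diag3 e f h $ 1 $ 2 = 0" "diag3 e f h $ 1 $ 3 = 0"
  "diag3 e f h $ 2 $ 1 = 0" "diag3 e f h $ 2 $ 2 = f" "diag3 e f h $ 2 $ 3 = 0"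
  "diag3 e f h $ 3 $ 1 = 0" "diag3 e f h $ 3 $ 2 = 0" "diag3 e f h $ 3 $ 3 = h"
  by (simp_all add: diag3_def)

text \<open>\<open>matrix_inv\<close> chooses some two-sided inverse. For square matrices a right
  inverse is two-sided, and associativity then forces the choice to be \<open>B\<close>.\<close>

lemma matrix_inv_eqI:
  fixes A :: "real ^ 'n ^ 'n"
  assumes "A ** B = mat 1"
  shows "matrix_inv A = B"
proof -
  have BA: "B ** A = mat 1"
    using assms matrix_left_right_inverse by blast
  have "A ** matrix_inv A = mat 1 \<and> matrix_inv A ** A = mat 1"
    unfolding matrix_inv_def by (rule someI[of _ B]) (use assms BA in blast)
  then show ?thesis
    by (metis assms matrix_mul_assoc matrix_mul_lid matrix_mul_rid)
qed

lemma matrix_inv_diag3: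
  assumes "e \<noteq> 0" "f \<noteq> 0" "h \<noteq> 0"
  shows "matrix_inv (diag3 e f h) = diag3 (1 / e) (1 / f) (1 / h)"
  by (rule matrix_inv_eqI)
    (use assms in \<open>simp add: vec_eq_iff forall_3 matrix_matrix_mult_def sum_3 mat_def\<close>)

lemma det_diag3: "det (diag3 e f h) = e * f * h"
  by (simp add: det_3)

text \<open>
  Here \<open>\<alpha>\<^sub>i, \<beta>\<^sub>i, \<gamma>\<^sub>i\<close> are the partial derivatives of \<open>\<alpha> = ln E / 2\<close>, \<open>\<beta> = ln F / 2\<close>,
  \<open>\<gamma> = ln H / 2\<close>; in these variables the scalar curvature has a short closed form.
\<close>

locale axisymmetric_diagonal_metric = open_set +
  fixes g :: "real ^ 3 \<Rightarrow> real ^ 3 ^ 3"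
    and E F H \<alpha>1 \<alpha>2 \<beta>1 \<beta>2 \<gamma>1 \<gamma>2 \<alpha>11 \<beta>11 \<gamma>11 \<alpha>22 \<beta>22 \<gamma>22 :: "real \<Rightarrow> real \<Rightarrow> real"
  assumes g_eq: "\<And>x. x \<in> U \<Longrightarrow>
      g x = diag3 (E (x $ 1) (x $ 2)) (F (x $ 1) (x $ 2)) (H (x $ 1) (x $ 2))"
    and pos: "\<And>x. x \<in> U \<Longrightarrow> E (x $ 1) (x $ 2) > 0"
      "\<And>x. x \<in> U \<Longrightarrow> F (x $ 1) (x $ 2) > 0"
      "\<And>x. x \<in> U \<Longrightarrow> H (x $ 1) (x $ 2) > 0"
    and deriv_r: "\<And>x. x \<in> U \<Longrightarrow>
        ((\<lambda>r. E r (x $ 2)) has_real_derivative 2 * E (x $ 1) (x $ 2) * \<alpha>1 (x $ 1) (x $ 2)) (at (x $ 1))"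
      "\<And>x. x \<in> U \<Longrightarrow>
        ((\<lambda>r. F r (x $ 2)) has_real_derivative 2 * F (x $ 1) (x $ 2) * \<beta>1 (x $ 1) (x $ 2)) (at (x $ 1))"
      "\<And>x. x \<in> U \<Longrightarrow>
        ((\<lambda>r. H r (x $ 2)) has_real_derivative 2 * H (x $ 1) (x $ 2) * \<gamma>1 (x $ 1) (x $ 2)) (at (x $ 1))"
    and deriv_th: "\<And>x. x \<in> U \<Longrightarrow>
        ((\<lambda>\<theta>. E (x $ 1) \<theta>) has_real_derivative 2 * E (x $ 1) (x $ 2) * \<alpha>2 (x $ 1) (x $ 2)) (at (x $ 2))"
      "\<And>x. x \<in> U \<Longrightarrow>
        ((\<lambda>\<theta>. F (x $ 1) \<theta>) has_real_derivative 2 * F (x $ 1) (x $ 2) * \<beta>2 (x $ 1) (x $ 2)) (at (x $ 2))"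
      "\<And>x. x \<in> U \<Longrightarrow>
        ((\<lambda>\<theta>. H (x $ 1) \<theta>) has_real_derivative 2 * H (x $ 1) (x $ 2) * \<gamma>2 (x $ 1) (x $ 2)) (at (x $ 2))"
    and deriv_rr: "\<And>x. x \<in> U \<Longrightarrow>
        ((\<lambda>r. \<alpha>1 r (x $ 2)) has_real_derivative \<alpha>11 (x $ 1) (x $ 2)) (at (x $ 1))"
      "\<And>x. x \<in> U \<Longrightarrow>
        ((\<lambda>r. \<beta>1 r (x $ 2)) has_real_derivative \<beta>11 (x $ 1) (x $ 2)) (at (x $ 1))"
      "\<And>x. x \<in> U \<Longrightarrow>
        ((\<lambda>r. \<gamma>1 r (x $ 2)) has_real_derivative \<gamma>11 (x $ 1) (x $ 2)) (at (x $ 1))"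
    and deriv_thth: "\<And>x. x \<in> U \<Longrightarrow>
        ((\<lambda>\<theta>. \<alpha>2 (x $ 1) \<theta>) has_real_derivative \<alpha>22 (x $ 1) (x $ 2)) (at (x $ 2))"
      "\<And>x. x \<in> U \<Longrightarrow>
        ((\<lambda>\<theta>. \<beta>2 (x $ 1) \<theta>) has_real_derivative \<beta>22 (x $ 1) (x $ 2)) (at (x $ 2))"
      "\<And>x. x \<in> U \<Longrightarrow>
        ((\<lambda>\<theta>. \<gamma>2 (x $ 1) \<theta>) has_real_derivative \<gamma>22 (x $ 1) (x $ 2)) (at (x $ 2))"
begin

lemma nz: "x \<in> U \<Longrightarrow> E (x $ 1) (x $ 2) \<noteq> 0" "x \<in> U \<Longrightarrow> F (x $ 1) (x $ 2) \<noteq> 0"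
    "x \<in> U \<Longrightarrow> H (x $ 1) (x $ 2) \<noteq> 0"
  using pos by (metis less_irrefl)+

lemma inv_metric_eq:
  assumes "x \<in> U"
  shows "inv_metric g x =
    diag3 (1 / E (x $ 1) (x $ 2)) (1 / F (x $ 1) (x $ 2)) (1 / H (x $ 1) (x $ 2))"
  using assms nz by (simp add: inv_metric_def g_eq matrix_inv_diag3)

lemma partial_metric_1:
  assumes "x \<in> U"
  shows "partial 1 (\<lambda>y. g y $ i $ j) x =
    diag3 (2 * E (x $ 1) (x $ 2) * \<alpha>1 (x $ 1) (x $ 2)) (2 * F (x $ 1) (x $ 2) * \<beta>1 (x $ 1) (x $ 2))
      (2 * H (x $ 1) (x $ 2) * \<gamma>1 (x $ 1) (x $ 2)) $ i $ j"
  by (rule partial_1I[where f="\<lambda>r \<theta>. diag3 (E r \<theta>) (F r \<theta>) (H r \<theta>) $ i $ j", OF assms],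
      simp add: g_eq)
    (use exhaust_3[of i] exhaust_3[of j] assms deriv_r in auto)

lemma partial_metric_2:
  assumes "x \<in> U"
  shows "partial 2 (\<lambda>y. g y $ i $ j) x =
    diag3 (2 * E (x $ 1) (x $ 2) * \<alpha>2 (x $ 1) (x $ 2)) (2 * F (x $ 1) (x $ 2) * \<beta>2 (x $ 1) (x $ 2))
      (2 * H (x $ 1) (x $ 2) * \<gamma>2 (x $ 1) (x $ 2)) $ i $ j"
  by (rule partial_2I[where f="\<lambda>r \<theta>. diag3 (E r \<theta>) (F r \<theta>) (H r \<theta>) $ i $ j", OF assms],
      simp add: g_eq)
    (use exhaust_3[of i] exhaust_3[of j] assms deriv_th in auto)

lemma partial_metric_3:
  assumes "x \<in> U"
  shows "partial 3 (\<lambda>y. g y $ i $ j) x = 0"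
  by (rule partial_3I[where f="\<lambda>r \<theta>. diag3 (E r \<theta>) (F r \<theta>) (H r \<theta>) $ i $ j", OF assms])
    (simp add: g_eq)

lemma christoffel_eq:
  assumes "x \<in> U"
  shows
    "christoffel g 1 1 1 x = \<alpha>1 (x $ 1) (x $ 2)"
    "christoffel g 1 1 2 x = \<alpha>2 (x $ 1) (x $ 2)"
    "christoffel g 1 2 1 x = \<alpha>2 (x $ 1) (x $ 2)"
    "christoffel g 1 2 2 x = - (F (x $ 1) (x $ 2) / E (x $ 1) (x $ 2) * \<beta>1 (x $ 1) (x $ 2))"
    "christoffel g 1 3 3 x = - (H (x $ 1) (x $ 2) / E (x $ 1) (x $ 2) * \<gamma>1 (x $ 1) (x $ 2))"
    "christoffel g 1 1 3 x = 0" "christoffel g 1 3 1 x = 0"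
    "christoffel g 1 2 3 x = 0" "christoffel g 1 3 2 x = 0"
    "christoffel g 2 1 1 x = - (E (x $ 1) (x $ 2) / F (x $ 1) (x $ 2) * \<alpha>2 (x $ 1) (x $ 2))"
    "christoffel g 2 1 2 x = \<beta>1 (x $ 1) (x $ 2)"
    "christoffel g 2 2 1 x = \<beta>1 (x $ 1) (x $ 2)"
    "christoffel g 2 2 2 x = \<beta>2 (x $ 1) (x $ 2)"
    "christoffel g 2 3 3 x = - (H (x $ 1) (x $ 2) / F (x $ 1) (x $ 2) * \<gamma>2 (x $ 1) (x $ 2))"
    "christoffel g 2 1 3 x = 0" "christoffel g 2 3 1 x = 0"
    "christoffel g 2 2 3 x = 0" "christoffel g 2 3 2 x = 0"
    "christoffel g 3 1 3 x = \<gamma>1 (x $ 1) (x $ 2)"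
    "christoffel g 3 3 1 x = \<gamma>1 (x $ 1) (x $ 2)"
    "christoffel g 3 2 3 x = \<gamma>2 (x $ 1) (x $ 2)"
    "christoffel g 3 3 2 x = \<gamma>2 (x $ 1) (x $ 2)"
    "christoffel g 3 1 1 x = 0" "christoffel g 3 2 2 x = 0" "christoffel g 3 3 3 x = 0"
    "christoffel g 3 1 2 x = 0" "christoffel g 3 2 1 x = 0"
  using nz[OF assms]
  by (simp_all add: christoffel_def sum_3 inv_metric_eq partial_metric_1 partial_metric_2
      partial_metric_3 assms)


text \<open>The inverse metric is diagonal, so only the three diagonal Ricci components enter the
  scalar curvature, and no mixed second derivative in r and \<theta> has to be known.\<close>

lemma ricci_11:
  assumes x: "x \<in> U"
  shows "ricci g 1 1 x =
    (let e = E (x $ 1) (x $ 2); f = F (x $ 1) (x $ 2);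
         a1 = \<alpha>1 (x $ 1) (x $ 2); b1 = \<beta>1 (x $ 1) (x $ 2); c1 = \<gamma>1 (x $ 1) (x $ 2);
         a2 = \<alpha>2 (x $ 1) (x $ 2); b2 = \<beta>2 (x $ 1) (x $ 2); c2 = \<gamma>2 (x $ 1) (x $ 2)
     in - (\<beta>11 (x $ 1) (x $ 2) + \<gamma>11 (x $ 1) (x $ 2) + b1\<^sup>2 + c1\<^sup>2 - a1 * (b1 + c1))
        - e / f * (\<alpha>22 (x $ 1) (x $ 2) + a2\<^sup>2 + a2 * c2 - a2 * b2))"
proof -
  have 1: "partial 1 (christoffel g 1 1 1) x = \<alpha>11 (x $ 1) (x $ 2)"
    "partial 1 (christoffel g 2 1 2) x = \<beta>11 (x $ 1) (x $ 2)"
    "partial 1 (christoffel g 3 1 3) x = \<gamma>11 (x $ 1) (x $ 2)"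
    by (rule partial_1I[where f="\<alpha>1", OF x christoffel_eq(1)] partial_1I[where f="\<beta>1", OF x christoffel_eq(11)]
        partial_1I[where f="\<gamma>1", OF x christoffel_eq(19)]; use deriv_rr x in simp)+
  \<comment> \<open>The \<theta>-derivative of \<open>E / F\<close> is
    \<open>2 * (E / F) * (\<alpha>2 - \<beta>2)\<close>, so the product rule keeps the prefactor
    \<open>E / F\<close>. The same pattern recurs in the other two components.\<close>
  have 2: "partial 2 (christoffel g 2 1 1) x = - (E (x $ 1) (x $ 2) / F (x $ 1) (x $ 2) *
      (\<alpha>22 (x $ 1) (x $ 2) + 2 * \<alpha>2 (x $ 1) (x $ 2) * (\<alpha>2 (x $ 1) (x $ 2) - \<beta>2 (x $ 1) (x $ 2))))"
    by (rule partial_2I[where f="\<lambda>r \<theta>. - (E r \<theta> / F r \<theta> * \<alpha>2 r \<theta>)", OF x christoffel_eq(10)], assumption,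
      rule DERIV_cong)
      (use nz[OF x] in \<open>auto intro!: derivative_eq_intros deriv_th deriv_thth x simp: field_simps power2_eq_square\<close>)
  have 3: "partial 3 (christoffel g 3 1 1) x = 0"
    by (rule partial_3I[where f="\<lambda>_ _. 0", OF x christoffel_eq(23)])
  show ?thesis
    unfolding ricci_def sum_3 1 2 3 christoffel_eq[OF x] Let_def
    using nz[OF x] by (simp add: field_simps power2_eq_square)
qed

lemma ricci_22:
  assumes x: "x \<in> U"
  shows "ricci g 2 2 x =
    (let e = E (x $ 1) (x $ 2); f = F (x $ 1) (x $ 2);
         a1 = \<alpha>1 (x $ 1) (x $ 2); b1 = \<beta>1 (x $ 1) (x $ 2); c1 = \<gamma>1 (x $ 1) (x $ 2);
         a2 = \<alpha>2 (x $ 1) (x $ 2); b2 = \<beta>2 (x $ 1) (x $ 2); c2 = \<gamma>2 (x $ 1) (x $ 2)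
     in - (\<alpha>22 (x $ 1) (x $ 2) + \<gamma>22 (x $ 1) (x $ 2) + a2\<^sup>2 + c2\<^sup>2 - b2 * (a2 + c2))
        - f / e * (\<beta>11 (x $ 1) (x $ 2) + b1\<^sup>2 + b1 * c1 - a1 * b1))"
proof -
  have 1: "partial 2 (christoffel g 1 2 1) x = \<alpha>22 (x $ 1) (x $ 2)"
    "partial 2 (christoffel g 2 2 2) x = \<beta>22 (x $ 1) (x $ 2)"
    "partial 2 (christoffel g 3 2 3) x = \<gamma>22 (x $ 1) (x $ 2)"
    by (rule partial_2I[where f="\<alpha>2", OF x christoffel_eq(3)] partial_2I[where f="\<beta>2", OF x christoffel_eq(13)]
        partial_2I[where f="\<gamma>2", OF x christoffel_eq(21)]; use deriv_thth x in simp)+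
  have 2: "partial 1 (christoffel g 1 2 2) x = - (F (x $ 1) (x $ 2) / E (x $ 1) (x $ 2) *
      (\<beta>11 (x $ 1) (x $ 2) + 2 * \<beta>1 (x $ 1) (x $ 2) * (\<beta>1 (x $ 1) (x $ 2) - \<alpha>1 (x $ 1) (x $ 2))))"
    by (rule partial_1I[where f="\<lambda>r \<theta>. - (F r \<theta> / E r \<theta> * \<beta>1 r \<theta>)", OF x christoffel_eq(4)], assumption,
      rule DERIV_cong)
      (use nz[OF x] in \<open>auto intro!: derivative_eq_intros deriv_r deriv_rr x simp: field_simps power2_eq_square\<close>)
  have 3: "partial 3 (christoffel g 3 2 2) x = 0"
    by (rule partial_3I[where f="\<lambda>_ _. 0", OF x christoffel_eq(24)])
  show ?thesis
    unfolding ricci_def sum_3 1 2 3 christoffel_eq[OF x] Let_def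
    using nz[OF x] by (simp add: field_simps power2_eq_square)
qed

lemma ricci_33:
  assumes x: "x \<in> U"
  shows "ricci g 3 3 x =
    (let e = E (x $ 1) (x $ 2); f = F (x $ 1) (x $ 2); h = H (x $ 1) (x $ 2);
         a1 = \<alpha>1 (x $ 1) (x $ 2); b1 = \<beta>1 (x $ 1) (x $ 2); c1 = \<gamma>1 (x $ 1) (x $ 2);
         a2 = \<alpha>2 (x $ 1) (x $ 2); b2 = \<beta>2 (x $ 1) (x $ 2); c2 = \<gamma>2 (x $ 1) (x $ 2)
     in - (h / e * (\<gamma>11 (x $ 1) (x $ 2) + c1\<^sup>2 + b1 * c1 - a1 * c1))
        - h / f * (\<gamma>22 (x $ 1) (x $ 2) + c2\<^sup>2 + a2 * c2 - b2 * c2))"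
proof -
  have 1: "partial 1 (christoffel g 1 3 3) x = - (H (x $ 1) (x $ 2) / E (x $ 1) (x $ 2) *
      (\<gamma>11 (x $ 1) (x $ 2) + 2 * \<gamma>1 (x $ 1) (x $ 2) * (\<gamma>1 (x $ 1) (x $ 2) - \<alpha>1 (x $ 1) (x $ 2))))"
    by (rule partial_1I[where f="\<lambda>r \<theta>. - (H r \<theta> / E r \<theta> * \<gamma>1 r \<theta>)", OF x christoffel_eq(5)], assumption,
      rule DERIV_cong)
      (use nz[OF x] in \<open>auto intro!: derivative_eq_intros deriv_r deriv_rr x simp: field_simps power2_eq_square\<close>)
  have 2: "partial 2 (christoffel g 2 3 3) x = - (H (x $ 1) (x $ 2) / F (x $ 1) (x $ 2) *
      (\<gamma>22 (x $ 1) (x $ 2) + 2 * \<gamma>2 (x $ 1) (x $ 2) * (\<gamma>2 (x $ 1) (x $ 2) - \<beta>2 (x $ 1) (x $ 2))))"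
    by (rule partial_2I[where f="\<lambda>r \<theta>. - (H r \<theta> / F r \<theta> * \<gamma>2 r \<theta>)", OF x christoffel_eq(14)], assumption,
      rule DERIV_cong)
      (use nz[OF x] in \<open>auto intro!: derivative_eq_intros deriv_th deriv_thth x simp: field_simps power2_eq_square\<close>)
  have 3: "partial 3 (christoffel g 3 3 3) x = 0" "partial 3 (christoffel g 1 3 1) x = 0"
    "partial 3 (christoffel g 2 3 2) x = 0"
    by (rule partial_3I[where f="\<lambda>_ _. 0", OF x christoffel_eq(25)] partial_3I[where f="\<lambda>_ _. 0", OF x christoffel_eq(7)]
        partial_3I[where f="\<lambda>_ _. 0", OF x christoffel_eq(18)]; assumption)+
  show ?thesis
    unfolding ricci_def sum_3 1 2 3 christoffel_eq[OF x] Let_def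
    using nz[OF x] by (simp add: field_simps power2_eq_square)
qed

text \<open>Each surviving second derivative occurs in exactly two of the quotients of a Ricci
  component by its metric component, which explains the overall factors 2.\<close>

lemma scalar_curvature_eq:
  assumes x: "x \<in> U"
  shows "scalar_curvature g x =
    (let e = E (x $ 1) (x $ 2); f = F (x $ 1) (x $ 2);
         a1 = \<alpha>1 (x $ 1) (x $ 2); b1 = \<beta>1 (x $ 1) (x $ 2); c1 = \<gamma>1 (x $ 1) (x $ 2);
         a2 = \<alpha>2 (x $ 1) (x $ 2); b2 = \<beta>2 (x $ 1) (x $ 2); c2 = \<gamma>2 (x $ 1) (x $ 2)
     in - (2 / e * (\<beta>11 (x $ 1) (x $ 2) + \<gamma>11 (x $ 1) (x $ 2)
                    + b1\<^sup>2 + c1\<^sup>2 + b1 * c1 - a1 * (b1 + c1)))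
        - 2 / f * (\<alpha>22 (x $ 1) (x $ 2) + \<gamma>22 (x $ 1) (x $ 2)
                   + a2\<^sup>2 + c2\<^sup>2 + a2 * c2 - b2 * (a2 + c2)))"
  unfolding scalar_curvature_def sum_3 inv_metric_eq[OF x] ricci_11[OF x] ricci_22[OF x]
    ricci_33[OF x] Let_def
  using nz[OF x] by (simp add: field_simps power2_eq_square)

end

section \<open>Constraints for a momentum with exactly one index \<phi>\<close>

text \<open>The Kerr metric is invariant under (t, \<phi>) -> (-t, -\<phi>), while the unit normal
  changes sign; hence only momentum components with one index \<phi> survive.\<close>

definition offdiag3 :: "real \<Rightarrow> real \<Rightarrow> real ^ 3 ^ 3" where
  "offdiag3 p q = vector [vector [0, 0, p], vector [0, 0, q], vector [p, q, 0]]"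

lemma offdiag3_nth [simp]:
  "offdiag3 p q $ 1 $ 1 = 0" "offdiag3 p q $ 1 $ 2 = 0" "offdiag3 p q $ 1 $ 3 = p"
  "offdiag3 p q $ 2 $ 1 = 0" "offdiag3 p q $ 2 $ 2 = 0" "offdiag3 p q $ 2 $ 3 = q"
  "offdiag3 p q $ 3 $ 1 = p" "offdiag3 p q $ 3 $ 2 = q" "offdiag3 p q $ 3 $ 3 = 0"
  by (simp_all add: offdiag3_def)

context axisymmetric_diagonal_metric
begin

text \<open>The trace of \<open>P\<close> vanishes against a diagonal metric, and the quadratic term
  is 2 h (e p^2 + f q^2). The factor h also divides det g = e f h, so cancelling it leaves the
  assumption on R.\<close>

lemma hamiltonian_constraint_zeroI:
  assumes x: "x \<in> U" and P: "P x = offdiag3 p q"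
    and R: "scalar_curvature g x * (E (x $ 1) (x $ 2) * F (x $ 1) (x $ 2)) =
      2 * (E (x $ 1) (x $ 2) * p\<^sup>2 + F (x $ 1) (x $ 2) * q\<^sup>2)"
  shows "hamiltonian_constraint g P x = 0"
proof -
  define e f h where defs: "e = E (x $ 1) (x $ 2)" "f = F (x $ 1) (x $ 2)" "h = H (x $ 1) (x $ 2)"
  have pos': "e > 0" "f > 0" "h > 0"
    using pos x by (simp_all add: defs)
  have det: "det (g x) = e * f * h"
    using x by (simp add: g_eq det_diag3 defs)
  have quad: "(\<Sum>i\<in>UNIV. \<Sum>j\<in>UNIV. P x $ i $ j * lower_both g P x $ i $ j) =
      2 * h * (e * p\<^sup>2 + f * q\<^sup>2)"
    using x by (simp add: P lower_both_def g_eq defs sum_3 matrix_matrix_mult_def transpose_def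
        power2_eq_square algebra_simps)
  have tr: "(\<Sum>i\<in>UNIV. \<Sum>j\<in>UNIV. g x $ i $ j * P x $ i $ j) = 0"
    using x by (simp add: P g_eq sum_3)
  have "scalar_curvature g x * det (g x) = 2 * h * (e * p\<^sup>2 + f * q\<^sup>2)"
    using arg_cong[OF R, of "\<lambda>z. h * z"] by (simp add: det defs algebra_simps)
  moreover have "det (g x) > 0"
    using pos' by (simp add: det)
  ultimately show ?thesis
    unfolding hamiltonian_constraint_def quad tr by (simp add: field_simps)
qed

text \<open>For i = 1, 2 all terms vanish by the shape of \<open>T\<close> and independence of
  \<phi>. For i = 3 the vector field of \<phi>-translations is Killing, so the constraint reduces to
  the ordinary divergence of (H p, H q), which is d - d.\<close>

lemma momentum_constraint_zeroI:
  assumes x: "x \<in> U"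
    and P: "\<And>y. y \<in> U \<Longrightarrow> P y = offdiag3 (p (y $ 1) (y $ 2)) (q (y $ 1) (y $ 2))"
    and d1: "((\<lambda>r. H r (x $ 2) * p r (x $ 2)) has_real_derivative d) (at (x $ 1))"
    and d2: "((\<lambda>\<theta>. H (x $ 1) \<theta> * q (x $ 1) \<theta>) has_real_derivative - d) (at (x $ 2))"
  shows "momentum_constraint g P i x = 0"
proof -
  define T where "T = lower_first g P"
  have T: "T y $ 1 $ 1 = 0" "T y $ 1 $ 2 = 0" "T y $ 2 $ 1 = 0" "T y $ 2 $ 2 = 0" "T y $ 3 $ 3 = 0"
    "T y $ 1 $ 3 = E (y $ 1) (y $ 2) * p (y $ 1) (y $ 2)"
    "T y $ 2 $ 3 = F (y $ 1) (y $ 2) * q (y $ 1) (y $ 2)"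
    "T y $ 3 $ 1 = H (y $ 1) (y $ 2) * p (y $ 1) (y $ 2)"
    "T y $ 3 $ 2 = H (y $ 1) (y $ 2) * q (y $ 1) (y $ 2)" if "y \<in> U" for y
    using that by (simp_all add: T_def lower_first_def P g_eq sum_3 matrix_matrix_mult_def)
  have 0: "partial k (\<lambda>y. T y $ i $ j) x = 0"
    if "(i, j) \<in> {(1, 1), (1, 2), (2, 1), (2, 2), (3, 3)}" for k i j
    by (rule partial_const_on[OF open_U x, where k = 0]) (use that T in auto)
  have 1: "partial 1 (\<lambda>y. T y $ 3 $ 1) x = d"
    by (rule partial_1I[where f="\<lambda>r \<theta>. H r \<theta> * p r \<theta>", OF x T(8) d1])
  have 2: "partial 2 (\<lambda>y. T y $ 3 $ 2) x = - d"
    by (rule partial_2I[where f="\<lambda>r \<theta>. H r \<theta> * q r \<theta>", OF x T(9) d2])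
  have 3: "partial 3 (\<lambda>y. T y $ 1 $ 3) x = 0"
    by (rule partial_3I[where f="\<lambda>r \<theta>. E r \<theta> * p r \<theta>", OF x T(6)])
  have 4: "partial 3 (\<lambda>y. T y $ 2 $ 3) x = 0"
    by (rule partial_3I[where f="\<lambda>r \<theta>. F r \<theta> * q r \<theta>", OF x T(7)])
  have "(\<Sum>j\<in>UNIV. cov_deriv_mixed_density g T j i j x) = 0"
    using exhaust_3[of i] nz[OF x]
    by (elim disjE) (simp_all add: cov_deriv_mixed_density_def sum_3 0 1 2 3 4 T[OF x] christoffel_eq[OF x] algebra_simps)
  then show ?thesis
    by (simp add: momentum_constraint_def T_def)
qed

end

subsection \<open>Kerr metric functions\<close>

text \<open>\<open>kerr_S\<close>, \<open>kerr_D\<close> and \<open>kerr_A\<close> are the usual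
  \<Sigma>, \<Delta> and A of the Kerr literature.\<close>

definition kerr_S :: "real \<Rightarrow> real \<Rightarrow> real \<Rightarrow> real" where
  "kerr_S a r \<theta> = r\<^sup>2 + a\<^sup>2 * (cos \<theta>)\<^sup>2"

definition kerr_D :: "real \<Rightarrow> real \<Rightarrow> real \<Rightarrow> real" where
  "kerr_D m a r = r\<^sup>2 - 2 * m * r + a\<^sup>2"

definition kerr_A :: "real \<Rightarrow> real \<Rightarrow> real \<Rightarrow> real \<Rightarrow> real" where
  "kerr_A m a r \<theta> = (r\<^sup>2 + a\<^sup>2)\<^sup>2 - a\<^sup>2 * kerr_D m a r * (sin \<theta>)\<^sup>2"

text \<open>Divided by S, this is the form in which \<open>kerr\<close> writes the \<phi>\<phi>
  component. It also isolates the mass in a single term linear in r, the only one that can be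
  negative for r > 0.\<close>

lemma kerr_A_alt:
  "kerr_A m a r \<theta> = (r\<^sup>2 + a\<^sup>2) * kerr_S a r \<theta> + 2 * m * a\<^sup>2 * r * (sin \<theta>)\<^sup>2"
  unfolding kerr_A_def kerr_S_def kerr_D_def cos_squared_eq by algebra

definition kerr_Ar :: "real \<Rightarrow> real \<Rightarrow> real \<Rightarrow> real \<Rightarrow> real" where
  "kerr_Ar m a r \<theta> = 4 * r * (r\<^sup>2 + a\<^sup>2) - a\<^sup>2 * (sin \<theta>)\<^sup>2 * (2 * r - 2 * m)"

text \<open>This is A - r Ar, that is A^2 times the r-derivative of r / A, hence the radial gradient
  of the frame-dragging velocity up to the factor 2 m a / A^2. The mass drops out because its term
  in A is linear in r.\<close>

definition kerr_W :: "real \<Rightarrow> real \<Rightarrow> real \<Rightarrow> real" where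
  "kerr_W a r \<theta> = a\<^sup>2 * (cos \<theta>)\<^sup>2 * (a\<^sup>2 - r\<^sup>2) - 3 * r ^ 4 - a\<^sup>2 * r\<^sup>2"

lemma kerr_W_eq: "kerr_A m a r \<theta> - r * kerr_Ar m a r \<theta> = kerr_W a r \<theta>"
  unfolding kerr_A_def kerr_Ar_def kerr_W_def kerr_D_def cos_squared_eq by algebra

text \<open>\<open>kerr_p\<close> and \<open>kerr_q\<close> are the components \<open>r\<phi>\<close> and \<open>\<theta>\<phi>\<close> of the momentum.\<close>

definition kerr_p :: "real \<Rightarrow> real \<Rightarrow> real \<Rightarrow> real \<Rightarrow> real" where
  "kerr_p m a r \<theta> = m * a * sin \<theta> * kerr_W a r \<theta> / (kerr_S a r \<theta> * kerr_A m a r \<theta>)"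

definition kerr_q :: "real \<Rightarrow> real \<Rightarrow> real \<Rightarrow> real \<Rightarrow> real" where
  "kerr_q m a r \<theta> =
    2 * m * a ^ 3 * r * (sin \<theta>)\<^sup>2 * cos \<theta> / (kerr_S a r \<theta> * kerr_A m a r \<theta>)"

lemma kerr_pos:
  assumes "r > 0" "r \<ge> 2 * \<bar>m\<bar>"
  shows kerr_S_pos: "kerr_S a r \<theta> > 0" and kerr_D_pos: "r > 2 * m \<Longrightarrow> kerr_D m a r > 0"
    and kerr_A_pos: "kerr_A m a r \<theta> > 0"
proof -
  show S: "kerr_S a r \<theta> > 0"
    using assms by (simp add: kerr_S_def add_pos_nonneg)
  show "kerr_D m a r > 0" if "r > 2 * m"
  proof -
    have "0 < r * (r - 2 * m)"
      using assms that by simp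
    then have "0 < r * (r - 2 * m) + a\<^sup>2"
      by (simp add: add_pos_nonneg)
    then show ?thesis
      by (simp add: kerr_D_def power2_eq_square algebra_simps)
  qed
  \<comment> \<open>For m < 0 the mass term of A is negative; r >= 2 |m| bounds its size by r^2 a^2,
    which the expansion of (r^2 + a^2) S absorbs. The bound is independent of a.\<close>
  have "- (2 * m * r) \<le> r\<^sup>2"
    using mult_right_mono[of "-2 * m" r r] assms by (simp add: power2_eq_square)
  then have "- (2 * m * r) * (a\<^sup>2 * (sin \<theta>)\<^sup>2) \<le> r\<^sup>2 * (a\<^sup>2 * (sin \<theta>)\<^sup>2)"
    by (intro mult_right_mono) auto
  also have "\<dots> \<le> r\<^sup>2 * a\<^sup>2"
    by (simp add: mult_left_mono mult_left_le abs_square_le_1)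
  finally have "- (2 * m * a\<^sup>2 * r * (sin \<theta>)\<^sup>2) \<le> r\<^sup>2 * a\<^sup>2"
    by (simp add: algebra_simps)
  moreover have "(r\<^sup>2 + a\<^sup>2) * kerr_S a r \<theta> = r ^ 4 + r\<^sup>2 * a\<^sup>2 + (r\<^sup>2 + a\<^sup>2) * (a\<^sup>2 * (cos \<theta>)\<^sup>2)"
    by (simp add: kerr_S_def algebra_simps power2_eq_square power4_eq_xxxx)
  moreover have "r ^ 4 > 0" "(r\<^sup>2 + a\<^sup>2) * (a\<^sup>2 * (cos \<theta>)\<^sup>2) \<ge> 0"
    using assms by auto
  ultimately show "kerr_A m a r \<theta> > 0"
    unfolding kerr_A_alt by linarith
qed

lemma kerr_S_deriv:
  "((\<lambda>r. kerr_S a r \<theta>) has_real_derivative 2 * r) (at r)"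
  "((\<lambda>\<theta>. kerr_S a r \<theta>) has_real_derivative - 2 * a\<^sup>2 * sin \<theta> * cos \<theta>) (at \<theta>)"
  unfolding kerr_S_def by (auto intro!: derivative_eq_intros)

lemma kerr_D_deriv: "(kerr_D m a has_real_derivative 2 * (r - m)) (at r)"
  unfolding kerr_D_def[abs_def] by (auto intro!: derivative_eq_intros)

lemma kerr_A_deriv:
  "((\<lambda>r. kerr_A m a r \<theta>) has_real_derivative kerr_Ar m a r \<theta>) (at r)"
  "((\<lambda>r. kerr_Ar m a r \<theta>) has_real_derivative 12 * r\<^sup>2 + 4 * a\<^sup>2 - 2 * a\<^sup>2 * (sin \<theta>)\<^sup>2) (at r)"
  "((\<lambda>\<theta>. kerr_A m a r \<theta>) has_real_derivative - 2 * a\<^sup>2 * kerr_D m a r * sin \<theta> * cos \<theta>) (at \<theta>)"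
  unfolding kerr_A_def kerr_Ar_def
  by (auto intro!: derivative_eq_intros kerr_D_deriv simp: algebra_simps power2_eq_square)

text \<open>
  Half the logarithmic derivatives of \<open>g\<^sub>r\<^sub>r = S / D\<close>, \<open>g\<^sub>\<theta>\<^sub>\<theta> = S\<close>, \<open>g\<^sub>\<phi>\<^sub>\<phi> = A sin\<^sup>2 \<theta> / S\<close>; the
  \<open>\<theta>\<close>-derivatives of \<open>\<alpha>\<close> and \<open>\<beta>\<close> agree because \<open>D\<close> depends on \<open>r\<close> only.
\<close>

definition kerr_\<alpha>1 where "kerr_\<alpha>1 m a r \<theta> = r / kerr_S a r \<theta> - (r - m) / kerr_D m a r"
definition kerr_\<beta>1 where "kerr_\<beta>1 a r \<theta> = r / kerr_S a r \<theta>"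
definition kerr_\<gamma>1 where
  "kerr_\<gamma>1 m a r \<theta> = kerr_Ar m a r \<theta> / (2 * kerr_A m a r \<theta>) - r / kerr_S a r \<theta>"
definition kerr_\<beta>2 where "kerr_\<beta>2 a r \<theta> = - (a\<^sup>2 * sin \<theta> * cos \<theta> / kerr_S a r \<theta>)"
definition kerr_\<gamma>2 where
  "kerr_\<gamma>2 m a r \<theta> = - (a\<^sup>2 * kerr_D m a r * sin \<theta> * cos \<theta> / kerr_A m a r \<theta>)
    + a\<^sup>2 * sin \<theta> * cos \<theta> / kerr_S a r \<theta> + cos \<theta> / sin \<theta>"

definition kerr_\<beta>11 where
  "kerr_\<beta>11 a r \<theta> = 1 / kerr_S a r \<theta> - 2 * r\<^sup>2 / (kerr_S a r \<theta>)\<^sup>2"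
definition kerr_\<alpha>11 where
  "kerr_\<alpha>11 m a r \<theta> = kerr_\<beta>11 a r \<theta> - 1 / kerr_D m a r + 2 * (r - m)\<^sup>2 / (kerr_D m a r)\<^sup>2"
definition kerr_\<gamma>11 where
  "kerr_\<gamma>11 m a r \<theta> = (12 * r\<^sup>2 + 4 * a\<^sup>2 - 2 * a\<^sup>2 * (sin \<theta>)\<^sup>2) / (2 * kerr_A m a r \<theta>)
    - (kerr_Ar m a r \<theta>)\<^sup>2 / (2 * (kerr_A m a r \<theta>)\<^sup>2) - kerr_\<beta>11 a r \<theta>"
definition kerr_\<beta>22 where
  "kerr_\<beta>22 a r \<theta> = - (a\<^sup>2 * ((cos \<theta>)\<^sup>2 - (sin \<theta>)\<^sup>2) / kerr_S a r \<theta>)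
    - 2 * a ^ 4 * (sin \<theta>)\<^sup>2 * (cos \<theta>)\<^sup>2 / (kerr_S a r \<theta>)\<^sup>2"
definition kerr_\<gamma>22 where
  "kerr_\<gamma>22 m a r \<theta> = - (a\<^sup>2 * kerr_D m a r * ((cos \<theta>)\<^sup>2 - (sin \<theta>)\<^sup>2) / kerr_A m a r \<theta>)
    - 2 * a ^ 4 * (kerr_D m a r)\<^sup>2 * (sin \<theta>)\<^sup>2 * (cos \<theta>)\<^sup>2 / (kerr_A m a r \<theta>)\<^sup>2
    - kerr_\<beta>22 a r \<theta> - 1 / (sin \<theta>)\<^sup>2"

lemma kerr_log_deriv_r:
  assumes "kerr_S a r \<theta> \<noteq> 0" "kerr_D m a r \<noteq> 0" "kerr_A m a r \<theta> \<noteq> 0"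
  shows
    "((\<lambda>r. kerr_S a r \<theta> / kerr_D m a r) has_real_derivative
       2 * (kerr_S a r \<theta> / kerr_D m a r) * kerr_\<alpha>1 m a r \<theta>) (at r)"
    "((\<lambda>r. kerr_S a r \<theta>) has_real_derivative 2 * kerr_S a r \<theta> * kerr_\<beta>1 a r \<theta>) (at r)"
    "((\<lambda>r. kerr_A m a r \<theta> * (sin \<theta>)\<^sup>2 / kerr_S a r \<theta>) has_real_derivative
       2 * (kerr_A m a r \<theta> * (sin \<theta>)\<^sup>2 / kerr_S a r \<theta>) * kerr_\<gamma>1 m a r \<theta>) (at r)"
    "((\<lambda>r. kerr_\<alpha>1 m a r \<theta>) has_real_derivative kerr_\<alpha>11 m a r \<theta>) (at r)"
    "((\<lambda>r. kerr_\<beta>1 a r \<theta>) has_real_derivative kerr_\<beta>11 a r \<theta>) (at r)"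
    "((\<lambda>r. kerr_\<gamma>1 m a r \<theta>) has_real_derivative kerr_\<gamma>11 m a r \<theta>) (at r)"
proof -
  note [derivative_intros] = kerr_S_deriv(1) kerr_D_deriv kerr_A_deriv(1,2)
  show "((\<lambda>r. kerr_S a r \<theta> / kerr_D m a r) has_real_derivative
       2 * (kerr_S a r \<theta> / kerr_D m a r) * kerr_\<alpha>1 m a r \<theta>) (at r)"
    unfolding kerr_\<alpha>1_def
    by (rule derivative_eq_intros refl assms)+ (use assms in \<open>simp add: field_simps\<close>)
  show "((\<lambda>r. kerr_S a r \<theta>) has_real_derivative 2 * kerr_S a r \<theta> * kerr_\<beta>1 a r \<theta>) (at r)"
    unfolding kerr_\<beta>1_def
    by (rule derivative_eq_intros refl assms)+ (use assms in \<open>simp add: field_simps\<close>)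
  show "((\<lambda>r. kerr_A m a r \<theta> * (sin \<theta>)\<^sup>2 / kerr_S a r \<theta>) has_real_derivative
       2 * (kerr_A m a r \<theta> * (sin \<theta>)\<^sup>2 / kerr_S a r \<theta>) * kerr_\<gamma>1 m a r \<theta>) (at r)"
    unfolding kerr_\<gamma>1_def
    by (rule derivative_eq_intros refl assms)+ (use assms in \<open>simp add: field_simps\<close>)
  show B: "((\<lambda>r. kerr_\<beta>1 a r \<theta>) has_real_derivative kerr_\<beta>11 a r \<theta>) (at r)"
    unfolding kerr_\<beta>1_def kerr_\<beta>11_def
    by (rule derivative_eq_intros refl assms)+ (use assms in \<open>simp add: field_simps power2_eq_square\<close>)
  have "((\<lambda>r. kerr_\<beta>1 a r \<theta> - (r - m) / kerr_D m a r) has_real_derivative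
      kerr_\<alpha>11 m a r \<theta>) (at r)"
    unfolding kerr_\<alpha>11_def
    by (rule derivative_eq_intros refl assms B)+ (use assms in \<open>simp add: field_simps power2_eq_square\<close>)
  then show "((\<lambda>r. kerr_\<alpha>1 m a r \<theta>) has_real_derivative kerr_\<alpha>11 m a r \<theta>) (at r)"
    by (simp add: kerr_\<alpha>1_def kerr_\<beta>1_def)
  have "((\<lambda>r. kerr_Ar m a r \<theta> / (2 * kerr_A m a r \<theta>)) has_real_derivative
      (12 * r\<^sup>2 + 4 * a\<^sup>2 - 2 * a\<^sup>2 * (sin \<theta>)\<^sup>2) / (2 * kerr_A m a r \<theta>)
      - (kerr_Ar m a r \<theta>)\<^sup>2 / (2 * (kerr_A m a r \<theta>)\<^sup>2)) (at r)"
    by (rule DERIV_cong[OF DERIV_divide[OF kerr_A_deriv(2) DERIV_cmult[OF kerr_A_deriv(1), of 2]]])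
      (use assms in \<open>simp_all add: field_simps power2_eq_square\<close>)
  from DERIV_diff[OF this B]
  have "((\<lambda>r. kerr_Ar m a r \<theta> / (2 * kerr_A m a r \<theta>) - kerr_\<beta>1 a r \<theta>) has_real_derivative
      kerr_\<gamma>11 m a r \<theta>) (at r)"
    by (simp add: kerr_\<gamma>11_def)
  then show "((\<lambda>r. kerr_\<gamma>1 m a r \<theta>) has_real_derivative kerr_\<gamma>11 m a r \<theta>) (at r)"
    by (simp add: kerr_\<gamma>1_def kerr_\<beta>1_def)
qed

lemma kerr_log_deriv_th:
  assumes "kerr_S a r \<theta> \<noteq> 0" "kerr_D m a r \<noteq> 0" "kerr_A m a r \<theta> \<noteq> 0" "sin \<theta> \<noteq> 0"
  shows
    "((\<lambda>\<theta>. kerr_S a r \<theta> / kerr_D m a r) has_real_derivative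
       2 * (kerr_S a r \<theta> / kerr_D m a r) * kerr_\<beta>2 a r \<theta>) (at \<theta>)"
    "((\<lambda>\<theta>. kerr_S a r \<theta>) has_real_derivative 2 * kerr_S a r \<theta> * kerr_\<beta>2 a r \<theta>) (at \<theta>)"
    "((\<lambda>\<theta>. kerr_A m a r \<theta> * (sin \<theta>)\<^sup>2 / kerr_S a r \<theta>) has_real_derivative
       2 * (kerr_A m a r \<theta> * (sin \<theta>)\<^sup>2 / kerr_S a r \<theta>) * kerr_\<gamma>2 m a r \<theta>) (at \<theta>)"
    "((\<lambda>\<theta>. kerr_\<beta>2 a r \<theta>) has_real_derivative kerr_\<beta>22 a r \<theta>) (at \<theta>)"
    "((\<lambda>\<theta>. kerr_\<gamma>2 m a r \<theta>) has_real_derivative kerr_\<gamma>22 m a r \<theta>) (at \<theta>)"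
proof -
  note [derivative_intros] = kerr_S_deriv(2) kerr_A_deriv(3)
  show "((\<lambda>\<theta>. kerr_S a r \<theta> / kerr_D m a r) has_real_derivative
       2 * (kerr_S a r \<theta> / kerr_D m a r) * kerr_\<beta>2 a r \<theta>) (at \<theta>)"
    unfolding kerr_\<beta>2_def
    by (rule derivative_eq_intros refl assms)+ (use assms in \<open>simp add: field_simps\<close>)
  show "((\<lambda>\<theta>. kerr_S a r \<theta>) has_real_derivative 2 * kerr_S a r \<theta> * kerr_\<beta>2 a r \<theta>) (at \<theta>)"
    unfolding kerr_\<beta>2_def
    by (rule derivative_eq_intros refl assms)+ (use assms in \<open>simp add: field_simps\<close>)
  show "((\<lambda>\<theta>. kerr_A m a r \<theta> * (sin \<theta>)\<^sup>2 / kerr_S a r \<theta>) has_real_derivative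
       2 * (kerr_A m a r \<theta> * (sin \<theta>)\<^sup>2 / kerr_S a r \<theta>) * kerr_\<gamma>2 m a r \<theta>) (at \<theta>)"
    unfolding kerr_\<gamma>2_def
    by (rule derivative_eq_intros refl assms)+ (use assms in \<open>simp add: field_simps power2_eq_square\<close>)
  show B: "((\<lambda>\<theta>. kerr_\<beta>2 a r \<theta>) has_real_derivative kerr_\<beta>22 a r \<theta>) (at \<theta>)"
    unfolding kerr_\<beta>2_def kerr_\<beta>22_def
    by (rule derivative_eq_intros refl assms)+
      (use assms in \<open>simp add: field_simps power2_eq_square power4_eq_xxxx\<close>)
  have C: "((\<lambda>\<theta>. a\<^sup>2 * kerr_D m a r * sin \<theta> * cos \<theta> / kerr_A m a r \<theta>) has_real_derivative
      a\<^sup>2 * kerr_D m a r * ((cos \<theta>)\<^sup>2 - (sin \<theta>)\<^sup>2) / kerr_A m a r \<theta>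
      + 2 * a ^ 4 * (kerr_D m a r)\<^sup>2 * (sin \<theta>)\<^sup>2 * (cos \<theta>)\<^sup>2 / (kerr_A m a r \<theta>)\<^sup>2) (at \<theta>)"
    by (rule derivative_eq_intros refl assms)+
      (use assms in \<open>simp add: field_simps power2_eq_square power4_eq_xxxx\<close>)
  have "((\<lambda>\<theta>. cos \<theta> / sin \<theta>) has_real_derivative
      (- sin \<theta> * sin \<theta> - cos \<theta> * cos \<theta>) / (sin \<theta> * sin \<theta>)) (at \<theta>)"
    by (rule derivative_eq_intros refl assms)+ simp
  also have "- sin \<theta> * sin \<theta> - cos \<theta> * cos \<theta> = - 1"
    using sin_cos_squared_add[of \<theta>] by (simp add: power2_eq_square)
  finally have cot: "((\<lambda>\<theta>. cos \<theta> / sin \<theta>) has_real_derivative - 1 / (sin \<theta>)\<^sup>2) (at \<theta>)"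
    by (simp add: power2_eq_square)
  have "((\<lambda>\<theta>. - (a\<^sup>2 * kerr_D m a r * sin \<theta> * cos \<theta> / kerr_A m a r \<theta>) - kerr_\<beta>2 a r \<theta>
      + cos \<theta> / sin \<theta>) has_real_derivative kerr_\<gamma>22 m a r \<theta>) (at \<theta>)"
    using DERIV_add[OF DERIV_diff[OF DERIV_minus[OF C] B] cot]
    by (simp add: kerr_\<gamma>22_def)
  then show "((\<lambda>\<theta>. kerr_\<gamma>2 m a r \<theta>) has_real_derivative kerr_\<gamma>22 m a r \<theta>) (at \<theta>)"
    by (simp add: kerr_\<gamma>2_def[abs_def] kerr_\<beta>2_def)
qed

text \<open>Here \<open>b = a\<^sup>2\<close>, \<open>u = cos\<^sup>2 \<theta>\<close>, \<open>y = sin\<^sup>2 \<theta>\<close>.\<close>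

lemma kerr_hamiltonian_polynomial:
  fixes r m b u :: real
  assumes y: "y = 1 - u" and D: "D = r\<^sup>2 - 2 * m * r + b" and S: "S = r\<^sup>2 + b * u"
    and A: "A = (r\<^sup>2 + b)\<^sup>2 - b * D * y"
    and Ar: "Ar = 4 * r * (r\<^sup>2 + b) - b * y * (2 * r - 2 * m)"
    and Arr: "Arr = 12 * r\<^sup>2 + 4 * b - 2 * b * y"
    and W: "W = b * u * (b - r\<^sup>2) - 3 * r ^ 4 - b * r\<^sup>2"
  shows "D * (Arr / 2 * A * S\<^sup>2 - Ar\<^sup>2 / 2 * S\<^sup>2) + (r - m) / 2 * Ar * A * S\<^sup>2
    - b * D * (u - y) * A * S\<^sup>2 - 2 * b\<^sup>2 * D\<^sup>2 * y * u * S\<^sup>2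
    + D / 4 * (Ar * S - 2 * r * A)\<^sup>2 + b\<^sup>2 * y * u * (D * S - A)\<^sup>2
    - 2 * b * u * (D * S - A) * A * S - A\<^sup>2 * S\<^sup>2
    + m\<^sup>2 * b * y * W\<^sup>2 + 4 * m\<^sup>2 * b ^ 3 * D * r\<^sup>2 * y\<^sup>2 * u = 0"
  unfolding Ar Arr W A S unfolding D y by algebra

text \<open>The Hamiltonian constraint for g_rr = S / D and g_\<theta>\<theta> = S, after removal of
  the common factor 2 S / D. Multiplication by A^2 S^2 turns it into
  \<open>kerr_hamiltonian_polynomial\<close>.\<close>

lemma kerr_hamiltonian_identity:
  assumes nz: "kerr_S a r \<theta> \<noteq> 0" "kerr_D m a r \<noteq> 0" "kerr_A m a r \<theta> \<noteq> 0" "sin \<theta> \<noteq> 0"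
  shows "kerr_D m a r * (kerr_\<beta>11 a r \<theta> + kerr_\<gamma>11 m a r \<theta> + (kerr_\<beta>1 a r \<theta>)\<^sup>2 + (kerr_\<gamma>1 m a r \<theta>)\<^sup>2
        + kerr_\<beta>1 a r \<theta> * kerr_\<gamma>1 m a r \<theta> - kerr_\<alpha>1 m a r \<theta> * (kerr_\<beta>1 a r \<theta> + kerr_\<gamma>1 m a r \<theta>))
    + (kerr_\<beta>22 a r \<theta> + kerr_\<gamma>22 m a r \<theta> + (kerr_\<gamma>2 m a r \<theta>)\<^sup>2)
    + (kerr_p m a r \<theta>)\<^sup>2 + kerr_D m a r * (kerr_q m a r \<theta>)\<^sup>2 = 0" (is "?L = 0")
proof -
  define S D A Ar Arr W s c b where defs:
    "S = kerr_S a r \<theta>" "D = kerr_D m a r" "A = kerr_A m a r \<theta>" "Ar = kerr_Ar m a r \<theta>"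
    "Arr = 12 * r\<^sup>2 + 4 * a\<^sup>2 - 2 * a\<^sup>2 * (sin \<theta>)\<^sup>2" "W = kerr_W a r \<theta>" "s = sin \<theta>" "c = cos \<theta>" "b = a\<^sup>2"
  have nz': "S \<noteq> 0" "D \<noteq> 0" "A \<noteq> 0" "s \<noteq> 0"
    using nz by (simp_all add: defs)
  have sc: "s\<^sup>2 = 1 - c\<^sup>2"
    by (simp add: defs sin_squared_eq)
  \<comment> \<open>\<open>w1\<close> and \<open>w11\<close> are the first two r-derivatives of ln A
    / 2. They are the natural variables because \<beta> + \<gamma> equals ln A / 2 up to a function
    of \<theta>, so S cancels from the sum.\<close>
  define w1 where "w1 = Ar / (2 * A)"
  define w11 where "w11 = Arr / (2 * A) - Ar\<^sup>2 / (2 * A\<^sup>2)"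
  have 1: "D * (kerr_\<beta>11 a r \<theta> + kerr_\<gamma>11 m a r \<theta> + (kerr_\<beta>1 a r \<theta>)\<^sup>2 + (kerr_\<gamma>1 m a r \<theta>)\<^sup>2
        + kerr_\<beta>1 a r \<theta> * kerr_\<gamma>1 m a r \<theta> - kerr_\<alpha>1 m a r \<theta> * (kerr_\<beta>1 a r \<theta> + kerr_\<gamma>1 m a r \<theta>))
    = D * w11 + (r - m) * w1 + D * (w1 - r / S)\<^sup>2"
  proof -
    have eqs: "kerr_\<beta>11 a r \<theta> + kerr_\<gamma>11 m a r \<theta> = w11" "kerr_\<gamma>1 m a r \<theta> = w1 - r / S"
      "kerr_\<beta>1 a r \<theta> = r / S" "kerr_\<alpha>1 m a r \<theta> = r / S - (r - m) / D"
      by (simp_all add: defs kerr_\<gamma>11_def w11_def kerr_\<gamma>1_def w1_def kerr_\<beta>1_def kerr_\<alpha>1_def)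
    have "D * (w11 + \<beta>\<^sup>2 + (w1 - \<beta>)\<^sup>2 + \<beta> * (w1 - \<beta>) - (\<beta> - \<delta>) * (\<beta> + (w1 - \<beta>)))
        = D * w11 + D * \<delta> * w1 + D * (w1 - \<beta>)\<^sup>2" for \<beta> \<delta> :: real
      by algebra
    from this[of "r / S" "(r - m) / D"] show ?thesis
      unfolding eqs using nz' by simp
  qed
  have 2: "kerr_\<beta>22 a r \<theta> + kerr_\<gamma>22 m a r \<theta> + (kerr_\<gamma>2 m a r \<theta>)\<^sup>2
    = - (b * D * (c\<^sup>2 - s\<^sup>2) / A) - 2 * b\<^sup>2 * D\<^sup>2 * s\<^sup>2 * c\<^sup>2 / A\<^sup>2
      + b\<^sup>2 * s\<^sup>2 * c\<^sup>2 * (D / A - 1 / S)\<^sup>2 - 2 * b * c\<^sup>2 * (D / A - 1 / S) - 1"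
  proof -
    \<comment> \<open>The square of cot \<theta> in \<open>kerr_\<gamma>2\<close> and the term -1 /
      sin^2 in \<open>kerr_\<gamma>22\<close> are singular at the poles; together they give the
      constant -1, so no power of sin \<theta> remains in a denominator.\<close>
    have cot: "(c / s)\<^sup>2 - 1 / s\<^sup>2 = - 1"
      using nz' sc by (simp add: field_simps)
    have "kerr_\<gamma>2 m a r \<theta> = - (b * s * c * (D / A - 1 / S)) + c / s"
      by (simp add: kerr_\<gamma>2_def defs algebra_simps)
    moreover have "(- (b * s * c * X) + Y)\<^sup>2
        = b\<^sup>2 * s\<^sup>2 * c\<^sup>2 * X\<^sup>2 - 2 * b * c * X * (s * Y) + Y\<^sup>2" for X Y :: real
      by algebra
    ultimately have "(kerr_\<gamma>2 m a r \<theta>)\<^sup>2 = b\<^sup>2 * s\<^sup>2 * c\<^sup>2 * (D / A - 1 / S)\<^sup>2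
        - 2 * b * c * (D / A - 1 / S) * (s * (c / s)) + (c / s)\<^sup>2"
      by simp
    then have "(kerr_\<gamma>2 m a r \<theta>)\<^sup>2 = b\<^sup>2 * s\<^sup>2 * c\<^sup>2 * (D / A - 1 / S)\<^sup>2
        - 2 * b * c\<^sup>2 * (D / A - 1 / S) + (c / s)\<^sup>2"
      using nz' by (simp add: power2_eq_square mult_ac)
    moreover have "kerr_\<beta>22 a r \<theta> + kerr_\<gamma>22 m a r \<theta> =
        - (b * D * (c\<^sup>2 - s\<^sup>2) / A) - 2 * b\<^sup>2 * D\<^sup>2 * s\<^sup>2 * c\<^sup>2 / A\<^sup>2 - 1 / s\<^sup>2"
      by (simp add: kerr_\<gamma>22_def defs)
    ultimately show ?thesis
      using cot by linarith
  qed
  have 3: "(kerr_p m a r \<theta>)\<^sup>2 = m\<^sup>2 * b * s\<^sup>2 * W\<^sup>2 / (S\<^sup>2 * A\<^sup>2)"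
    by (simp add: kerr_p_def defs power_mult_distrib power_divide)
  have 4: "(kerr_q m a r \<theta>)\<^sup>2 = 4 * m\<^sup>2 * b ^ 3 * r\<^sup>2 * (s\<^sup>2)\<^sup>2 * c\<^sup>2 / (S\<^sup>2 * A\<^sup>2)"
    by (simp add: kerr_q_def defs power_mult_distrib power_divide flip: power_mult)
  have "?L * (A\<^sup>2 * S\<^sup>2) =
    D * (w11 * A\<^sup>2 * S\<^sup>2) + (r - m) * (w1 * A) * A * S\<^sup>2 + D * (w1 * A * S - r * A)\<^sup>2
    - b * D * (c\<^sup>2 - s\<^sup>2) * A * S\<^sup>2 - 2 * b\<^sup>2 * D\<^sup>2 * s\<^sup>2 * c\<^sup>2 * S\<^sup>2
    + b\<^sup>2 * s\<^sup>2 * c\<^sup>2 * (D * S - A)\<^sup>2 - 2 * b * c\<^sup>2 * (D * S - A) * A * S - A\<^sup>2 * S\<^sup>2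
    + m\<^sup>2 * b * s\<^sup>2 * W\<^sup>2 + D * (4 * m\<^sup>2 * b ^ 3 * r\<^sup>2 * (s\<^sup>2)\<^sup>2 * c\<^sup>2)"
  proof -
    have i: "(w1 - r / S)\<^sup>2 * (A\<^sup>2 * S\<^sup>2) = (w1 * A * S - r * A)\<^sup>2"
      using nz' by (simp add: field_simps flip: power_mult_distrib)
    have ii: "(D / A - 1 / S)\<^sup>2 * (A\<^sup>2 * S\<^sup>2) = (D * S - A)\<^sup>2"
      using nz' by (simp add: field_simps flip: power_mult_distrib)
    have iii: "(D / A - 1 / S) * (A\<^sup>2 * S\<^sup>2) = (D * S - A) * A * S"
      using nz' by (simp add: field_simps power2_eq_square)
    have iv: "b * D * (c\<^sup>2 - s\<^sup>2) / A * (A\<^sup>2 * S\<^sup>2) = b * D * (c\<^sup>2 - s\<^sup>2) * A * S\<^sup>2"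
      using nz' by (simp add: power2_eq_square)
    have v: "2 * b\<^sup>2 * D\<^sup>2 * s\<^sup>2 * c\<^sup>2 / A\<^sup>2 * (A\<^sup>2 * S\<^sup>2) = 2 * b\<^sup>2 * D\<^sup>2 * s\<^sup>2 * c\<^sup>2 * S\<^sup>2"
      using nz' by simp
    have vi: "z / (S\<^sup>2 * A\<^sup>2) * (A\<^sup>2 * S\<^sup>2) = z" for z :: real
      using nz' by simp
    \<comment> \<open>The quotients are replaced by opaque variables so that distributing the factor
      is a polynomial identity; the cancellations are then done separately by i to vi.\<close>
    have distr: "(D * x1 + x2 * x3 + D * x4 + (- t1 - t2 + t3 * t4 - t5 * t6 - 1) + t7 + D * t8) * (A\<^sup>2 * n)
      = D * (x1 * A\<^sup>2 * n) + x2 * (x3 * A) * A * n + D * (x4 * (A\<^sup>2 * n))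
        - t1 * (A\<^sup>2 * n) - t2 * (A\<^sup>2 * n) + t3 * (t4 * (A\<^sup>2 * n)) - t5 * (t6 * (A\<^sup>2 * n))
        - A\<^sup>2 * n + t7 * (A\<^sup>2 * n) + D * (t8 * (A\<^sup>2 * n))"
      for x1 x2 x3 x4 t1 t2 t3 t4 t5 t6 t7 t8 n :: real
      by (simp add: power2_eq_square algebra_simps)
    have "?L * (A\<^sup>2 * S\<^sup>2) =
      D * (w11 * A\<^sup>2 * S\<^sup>2) + (r - m) * (w1 * A) * A * S\<^sup>2 + D * ((w1 - r / S)\<^sup>2 * (A\<^sup>2 * S\<^sup>2))
      - b * D * (c\<^sup>2 - s\<^sup>2) / A * (A\<^sup>2 * S\<^sup>2) - 2 * b\<^sup>2 * D\<^sup>2 * s\<^sup>2 * c\<^sup>2 / A\<^sup>2 * (A\<^sup>2 * S\<^sup>2)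
      + b\<^sup>2 * s\<^sup>2 * c\<^sup>2 * ((D / A - 1 / S)\<^sup>2 * (A\<^sup>2 * S\<^sup>2))
      - 2 * b * c\<^sup>2 * ((D / A - 1 / S) * (A\<^sup>2 * S\<^sup>2)) - A\<^sup>2 * S\<^sup>2
      + m\<^sup>2 * b * s\<^sup>2 * W\<^sup>2 / (S\<^sup>2 * A\<^sup>2) * (A\<^sup>2 * S\<^sup>2)
      + D * (4 * m\<^sup>2 * b ^ 3 * r\<^sup>2 * (s\<^sup>2)\<^sup>2 * c\<^sup>2 / (S\<^sup>2 * A\<^sup>2) * (A\<^sup>2 * S\<^sup>2))"
      unfolding 3 4 defs(2)[symmetric] 1 2 by (simp only: distr)
    then show ?thesis
      unfolding i ii iii iv v vi by (simp add: algebra_simps)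
  qed
  also have "\<dots> = D * (Arr / 2 * A * S\<^sup>2 - Ar\<^sup>2 / 2 * S\<^sup>2) + (r - m) / 2 * Ar * A * S\<^sup>2
    - b * D * (c\<^sup>2 - s\<^sup>2) * A * S\<^sup>2 - 2 * b\<^sup>2 * D\<^sup>2 * s\<^sup>2 * c\<^sup>2 * S\<^sup>2
    + D / 4 * (Ar * S - 2 * r * A)\<^sup>2 + b\<^sup>2 * s\<^sup>2 * c\<^sup>2 * (D * S - A)\<^sup>2
    - 2 * b * c\<^sup>2 * (D * S - A) * A * S - A\<^sup>2 * S\<^sup>2
    + m\<^sup>2 * b * s\<^sup>2 * W\<^sup>2 + 4 * m\<^sup>2 * b ^ 3 * D * r\<^sup>2 * (s\<^sup>2)\<^sup>2 * c\<^sup>2"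
  proof -
    have i: "w1 * A = Ar / 2"
      using nz' by (simp add: w1_def)
    have w11: "w11 * A\<^sup>2 = Arr / 2 * A - Ar\<^sup>2 / 2"
      using nz' by (simp add: w11_def field_simps power2_eq_square)
    have ii: "w11 * A\<^sup>2 * S\<^sup>2 = Arr / 2 * A * S\<^sup>2 - Ar\<^sup>2 / 2 * S\<^sup>2"
      unfolding w11 by (rule left_diff_distrib)
    show ?thesis
      unfolding i ii by (simp add: field_simps power2_eq_square)
  qed
  also have "\<dots> = 0"
    by (rule kerr_hamiltonian_polynomial)
      (simp_all add: sc defs kerr_S_def kerr_D_def kerr_A_def kerr_Ar_def kerr_W_def sin_squared_eq)
  finally show ?thesis
    using nz' by simp
qed

text \<open>The two functions are H p and H q, in which A has cancelled. \<open>d\<close> is written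
  as minus the \<theta>-derivative of the second, so the work lies in matching it with the
  r-derivative of the first.\<close>

lemma kerr_momentum_deriv:
  assumes nz: "kerr_S a r \<theta> \<noteq> 0" "kerr_A m a r \<theta> \<noteq> 0"
  defines "d \<equiv> - (2 * m * a ^ 3 * r * (4 * (sin \<theta>) ^ 3 * (cos \<theta>)\<^sup>2 - (sin \<theta>) ^ 5) / (kerr_S a r \<theta>)\<^sup>2
     + 8 * m * a ^ 5 * r * (sin \<theta>) ^ 5 * (cos \<theta>)\<^sup>2 / (kerr_S a r \<theta>) ^ 3)"
  shows "((\<lambda>r. m * a * (sin \<theta>) ^ 3 * kerr_W a r \<theta> / (kerr_S a r \<theta>)\<^sup>2) has_real_derivative d) (at r)"
    "((\<lambda>\<theta>. 2 * m * a ^ 3 * r * (sin \<theta>) ^ 4 * cos \<theta> / (kerr_S a r \<theta>)\<^sup>2)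
      has_real_derivative - d) (at \<theta>)"
proof -
  note [derivative_intros] = kerr_S_deriv
  have W: "((\<lambda>r. kerr_W a r \<theta>) has_real_derivative
      - 2 * a\<^sup>2 * (cos \<theta>)\<^sup>2 * r - 12 * r ^ 3 - 2 * a\<^sup>2 * r) (at r)"
    unfolding kerr_W_def by (auto intro!: derivative_eq_intros)
  define S s c where defs: "S = kerr_S a r \<theta>" "s = sin \<theta>" "c = cos \<theta>"
  have nz': "S \<noteq> 0" using nz by (simp add: defs)
  have S: "S = r\<^sup>2 + a\<^sup>2 * c\<^sup>2" by (simp add: defs kerr_S_def)
  have sc: "s\<^sup>2 = 1 - c\<^sup>2" by (simp add: defs sin_squared_eq)
  \<comment> \<open>After multiplication by S^3 both forms of \<open>d\<close> are polynomials,
    equal by S = r^2 + a^2 c^2 and s^2 = 1 - c^2.\<close>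
  have "d * S ^ 3 = - (2 * m * a ^ 3 * r * s ^ 3 * ((4 * c\<^sup>2 - s\<^sup>2) * S + 4 * a\<^sup>2 * s\<^sup>2 * c\<^sup>2))"
    using nz' unfolding d_def defs[symmetric]
    by (simp add: field_simps power2_eq_square power3_eq_cube eval_nat_numeral)
  also have "\<dots> = m * a * s ^ 3 * ((- 2 * a\<^sup>2 * c\<^sup>2 * r - 12 * r ^ 3 - 2 * a\<^sup>2 * r) * S
      - 4 * r * (a\<^sup>2 * c\<^sup>2 * (a\<^sup>2 - r\<^sup>2) - 3 * r ^ 4 - a\<^sup>2 * r\<^sup>2))"
    unfolding S sc by algebra
  finally have d: "d = m * a * s ^ 3 * ((- 2 * a\<^sup>2 * c\<^sup>2 * r - 12 * r ^ 3 - 2 * a\<^sup>2 * r) * S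
      - 4 * r * kerr_W a r \<theta>) / S ^ 3"
    using nz' by (simp add: field_simps kerr_W_def defs)
  show "((\<lambda>r. m * a * (sin \<theta>) ^ 3 * kerr_W a r \<theta> / (kerr_S a r \<theta>)\<^sup>2) has_real_derivative d) (at r)"
    unfolding d defs using nz
    by (auto intro!: derivative_eq_intros W simp: field_simps power2_eq_square power3_eq_cube)
  show "((\<lambda>\<theta>. 2 * m * a ^ 3 * r * (sin \<theta>) ^ 4 * cos \<theta> / (kerr_S a r \<theta>)\<^sup>2)
      has_real_derivative - d) (at \<theta>)"
    unfolding d_def using nz
    by (auto intro!: derivative_eq_intros simp: field_simps eval_nat_numeral)
qed

subsection \<open>Vacuum constraints on the Kerr slice\<close>

text \<open>The bound r' > 3 |m| gives r = r' - m > 2 |m| for either sign of m, which is what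
  \<open>kerr_pos\<close> needs, whatever the value of a.\<close>

definition kerr_region :: "real \<Rightarrow> (real ^ 3) set" where
  "kerr_region m = {x. 3 * \<bar>m\<bar> < x $ 1 \<and> 0 < x $ 2 \<and> x $ 2 < pi}"

lemma open_kerr_region: "open (kerr_region m)"
  unfolding kerr_region_def
  by (intro open_Collect_conj open_Collect_less continuous_intros)

lemma kerr_region_D:
  assumes "x \<in> kerr_region m"
  shows "x $ 1 - m > 0" "sin (x $ 2) > 0" "kerr_S a (x $ 1 - m) \<theta> > 0"
    "kerr_D m a (x $ 1 - m) > 0" "kerr_A m a (x $ 1 - m) \<theta> > 0"
proof -
  have r: "x $ 1 - m > 0" "x $ 1 - m \<ge> 2 * \<bar>m\<bar>" "x $ 1 - m > 2 * m"
    using assms by (auto simp: kerr_region_def)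
  then show "x $ 1 - m > 0" "kerr_S a (x $ 1 - m) \<theta> > 0"
    "kerr_D m a (x $ 1 - m) > 0" "kerr_A m a (x $ 1 - m) \<theta> > 0"
    using kerr_pos by blast+
  show "sin (x $ 2) > 0"
    using assms by (simp add: kerr_region_def sin_gt_zero)
qed

lemma DERIV_shift_diff:
  assumes "(f has_real_derivative d) (at (x - m))"
  shows "((\<lambda>r. f (r - m)) has_real_derivative d) (at x)"
  using DERIV_shift[of f d x "- m"] assms by simp

text \<open>Prescribing the data only on the region hides how they were obtained, so that both
  spacetimes, already in the coordinate r', can be instances.\<close>

locale kerr_slice =
  fixes m a :: real and g P :: "real ^ 3 \<Rightarrow> real ^ 3 ^ 3"
  assumes metric: "\<And>x. x \<in> kerr_region m \<Longrightarrow> g x =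
      diag3 (kerr_S a (x $ 1 - m) (x $ 2) / kerr_D m a (x $ 1 - m)) (kerr_S a (x $ 1 - m) (x $ 2))
        (kerr_A m a (x $ 1 - m) (x $ 2) * (sin (x $ 2))\<^sup>2 / kerr_S a (x $ 1 - m) (x $ 2))"
    and momentum: "\<And>x. x \<in> kerr_region m \<Longrightarrow>
      P x = offdiag3 (kerr_p m a (x $ 1 - m) (x $ 2)) (kerr_q m a (x $ 1 - m) (x $ 2))"

sublocale kerr_slice \<subseteq> axisymmetric_diagonal_metric "kerr_region m" g
  "\<lambda>r \<theta>. kerr_S a (r - m) \<theta> / kerr_D m a (r - m)"
  "\<lambda>r \<theta>. kerr_S a (r - m) \<theta>"
  "\<lambda>r \<theta>. kerr_A m a (r - m) \<theta> * (sin \<theta>)\<^sup>2 / kerr_S a (r - m) \<theta>"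
  "\<lambda>r. kerr_\<alpha>1 m a (r - m)" "\<lambda>r. kerr_\<beta>2 a (r - m)" "\<lambda>r. kerr_\<beta>1 a (r - m)"
  "\<lambda>r. kerr_\<beta>2 a (r - m)" "\<lambda>r. kerr_\<gamma>1 m a (r - m)" "\<lambda>r. kerr_\<gamma>2 m a (r - m)"
  "\<lambda>r. kerr_\<alpha>11 m a (r - m)" "\<lambda>r. kerr_\<beta>11 a (r - m)" "\<lambda>r. kerr_\<gamma>11 m a (r - m)"
  "\<lambda>r. kerr_\<beta>22 a (r - m)" "\<lambda>r. kerr_\<beta>22 a (r - m)" "\<lambda>r. kerr_\<gamma>22 m a (r - m)"
proof (unfold_locales, goal_cases)
  case 1
  show ?case by (rule open_kerr_region)
next
  case (2 x)
  then show ?case by (rule metric)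
next
  case (3 x)
  then show ?case by (simp add: kerr_region_D)
next
  case (4 x)
  then show ?case by (simp add: kerr_region_D)
next
  case (5 x)
  then show ?case using kerr_region_D(2,3,5)[OF 5] by simp
next
  case (6 x)
  show ?case
    by (rule DERIV_shift_diff, rule kerr_log_deriv_r) (use kerr_region_D[OF 6] in \<open>auto simp: less_imp_neq[symmetric]\<close>)
next
  case (7 x)
  show ?case
    by (rule DERIV_shift_diff, rule kerr_log_deriv_r(2)[where m=m]) (use kerr_region_D[OF 7] in \<open>auto simp: less_imp_neq[symmetric]\<close>)
next
  case (8 x)
  show ?case
    by (rule DERIV_shift_diff, rule kerr_log_deriv_r) (use kerr_region_D[OF 8] in \<open>auto simp: less_imp_neq[symmetric]\<close>)
next
  case (9 x)
  show ?case
    by (rule kerr_log_deriv_th) (use kerr_region_D[OF 9] in \<open>auto simp: less_imp_neq[symmetric]\<close>)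
next
  case (10 x)
  show ?case
    by (rule kerr_log_deriv_th(2)[where m=m]) (use kerr_region_D[OF 10] in \<open>auto simp: less_imp_neq[symmetric]\<close>)
next
  case (11 x)
  show ?case
    by (rule kerr_log_deriv_th) (use kerr_region_D[OF 11] in \<open>auto simp: less_imp_neq[symmetric]\<close>)
next
  case (12 x)
  show ?case
    by (rule DERIV_shift_diff, rule kerr_log_deriv_r) (use kerr_region_D[OF 12] in \<open>auto simp: less_imp_neq[symmetric]\<close>)
next
  case (13 x)
  show ?case
    by (rule DERIV_shift_diff, rule kerr_log_deriv_r(5)[where m=m]) (use kerr_region_D[OF 13] in \<open>auto simp: less_imp_neq[symmetric]\<close>)
next
  case (14 x)
  show ?case
    by (rule DERIV_shift_diff, rule kerr_log_deriv_r) (use kerr_region_D[OF 14] in \<open>auto simp: less_imp_neq[symmetric]\<close>)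
next
  case (15 x)
  show ?case
    by (rule kerr_log_deriv_th(4)[where m=m]) (use kerr_region_D[OF 15] in \<open>auto simp: less_imp_neq[symmetric]\<close>)
next
  case (16 x)
  show ?case
    by (rule kerr_log_deriv_th(5)) (use kerr_region_D[OF 16] in \<open>auto simp: less_imp_neq[symmetric]\<close>)
qed

context kerr_slice
begin

lemma hamiltonian_constraint_zero:
  assumes x: "x \<in> kerr_region m"
  shows "hamiltonian_constraint g P x = 0"
proof (rule hamiltonian_constraint_zeroI[where P = P, OF x momentum[OF x]])
  let ?r = "x $ 1 - m" and ?\<theta> = "x $ 2"
  define S D p q X1 X2 where defs: "S = kerr_S a ?r ?\<theta>" "D = kerr_D m a ?r"
    "p = kerr_p m a ?r ?\<theta>" "q = kerr_q m a ?r ?\<theta>"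
    "X1 = kerr_\<beta>11 a ?r ?\<theta> + kerr_\<gamma>11 m a ?r ?\<theta> + (kerr_\<beta>1 a ?r ?\<theta>)\<^sup>2 + (kerr_\<gamma>1 m a ?r ?\<theta>)\<^sup>2
      + kerr_\<beta>1 a ?r ?\<theta> * kerr_\<gamma>1 m a ?r ?\<theta>
      - kerr_\<alpha>1 m a ?r ?\<theta> * (kerr_\<beta>1 a ?r ?\<theta> + kerr_\<gamma>1 m a ?r ?\<theta>)"
    "X2 = kerr_\<beta>22 a ?r ?\<theta> + kerr_\<gamma>22 m a ?r ?\<theta> + (kerr_\<gamma>2 m a ?r ?\<theta>)\<^sup>2"
  have pos: "S > 0" "D > 0"
    using kerr_region_D[OF x] by (simp_all add: defs)
  have id: "D * X1 + X2 + p\<^sup>2 + D * q\<^sup>2 = 0"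
    unfolding defs
    by (rule kerr_hamiltonian_identity) (use kerr_region_D[OF x] in \<open>auto simp: less_imp_neq[symmetric]\<close>)
  \<comment> \<open>Here \<alpha>2 = \<beta>2, so the terms of the \<theta>-part of the curvature
    that involve \<open>kerr_\<beta>2\<close> cancel.\<close>
  have "kerr_\<beta>22 a ?r ?\<theta> + kerr_\<gamma>22 m a ?r ?\<theta> + (kerr_\<beta>2 a ?r ?\<theta>)\<^sup>2 + (kerr_\<gamma>2 m a ?r ?\<theta>)\<^sup>2
      + kerr_\<beta>2 a ?r ?\<theta> * kerr_\<gamma>2 m a ?r ?\<theta>
      - kerr_\<beta>2 a ?r ?\<theta> * (kerr_\<beta>2 a ?r ?\<theta> + kerr_\<gamma>2 m a ?r ?\<theta>) = X2"
    by (simp add: defs algebra_simps power2_eq_square)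
  then have "scalar_curvature g x = - (2 / (S / D) * X1) - 2 / S * X2"
    unfolding scalar_curvature_eq[OF x] Let_def by (simp only: defs)
  also have "\<dots> = - 2 / S * (D * X1 + X2)"
    using pos by (simp add: field_simps)
  finally have "scalar_curvature g x * (S / D * S) = - 2 * (S / D) * (D * X1 + X2)"
    using pos by simp
  also have "D * X1 + X2 = - (p\<^sup>2 + D * q\<^sup>2)"
    using id by linarith
  also have "- 2 * (S / D) * - (p\<^sup>2 + D * q\<^sup>2) = 2 * (S / D * p\<^sup>2 + S * q\<^sup>2)"
    using pos by (simp add: field_simps)
  finally show "scalar_curvature g x * (kerr_S a ?r ?\<theta> / kerr_D m a ?r * kerr_S a ?r ?\<theta>) =
      2 * (kerr_S a ?r ?\<theta> / kerr_D m a ?r * (kerr_p m a ?r ?\<theta>)\<^sup>2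
        + kerr_S a ?r ?\<theta> * (kerr_q m a ?r ?\<theta>)\<^sup>2)"
    by (simp only: defs)
qed

lemma momentum_constraint_zero:
  assumes x: "x \<in> kerr_region m"
  shows "momentum_constraint g P i x = 0"
proof -
  let ?r = "x $ 1 - m" and ?\<theta> = "x $ 2"
  have nz: "kerr_S a ?r ?\<theta> \<noteq> 0" "kerr_A m a ?r ?\<theta> \<noteq> 0"
    using kerr_region_D[OF x] by (auto simp: less_imp_neq[symmetric])
  note d = kerr_momentum_deriv[OF nz]
  have Hp: "kerr_A m a (y $ 1 - m) (y $ 2) * (sin (y $ 2))\<^sup>2 / kerr_S a (y $ 1 - m) (y $ 2)
      * kerr_p m a (y $ 1 - m) (y $ 2)
    = m * a * (sin (y $ 2)) ^ 3 * kerr_W a (y $ 1 - m) (y $ 2) / (kerr_S a (y $ 1 - m) (y $ 2))\<^sup>2"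
    and Hq: "kerr_A m a (y $ 1 - m) (y $ 2) * (sin (y $ 2))\<^sup>2 / kerr_S a (y $ 1 - m) (y $ 2)
      * kerr_q m a (y $ 1 - m) (y $ 2)
    = 2 * m * a ^ 3 * (y $ 1 - m) * (sin (y $ 2)) ^ 4 * cos (y $ 2) / (kerr_S a (y $ 1 - m) (y $ 2))\<^sup>2"
    if "y \<in> kerr_region m" for y
    using kerr_region_D(3,5)[OF that, of a "y $ 2"]
    by (simp_all add: kerr_p_def kerr_q_def field_simps eval_nat_numeral)
  \<comment> \<open>Cancelling A in \<open>Hp\<close> needs S and A nonzero, so the simplified
    function may replace the original only near the point. \<open>Hp\<close> speaks of points of the
    region, hence the lift of r to a point with the arbitrary value \<phi> = 0.\<close>
  have r1: "\<forall>\<^sub>F r in nhds (x $ 1). vector [r, ?\<theta>, 0] \<in> kerr_region m"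
  proof -
    have "\<forall>\<^sub>F r in nhds (x $ 1). r \<in> {3 * \<bar>m\<bar><..}"
      by (rule eventually_nhds_in_open) (use x in \<open>auto simp: kerr_region_def\<close>)
    then show ?thesis
      by eventually_elim (use x in \<open>auto simp: kerr_region_def\<close>)
  qed
  have r2: "\<forall>\<^sub>F \<theta> in nhds ?\<theta>. vector [x $ 1, \<theta>, 0] \<in> kerr_region m"
  proof -
    have "\<forall>\<^sub>F \<theta> in nhds ?\<theta>. \<theta> \<in> {0<..<pi}"
      by (rule eventually_nhds_in_open) (use x in \<open>auto simp: kerr_region_def\<close>)
    then show ?thesis
      by eventually_elim (use x in \<open>auto simp: kerr_region_def\<close>)
  qed
  show ?thesis
  proof (rule momentum_constraint_zeroI[where P = P, OF x momentum])
    show "((\<lambda>r. kerr_A m a (r - m) ?\<theta> * (sin ?\<theta>)\<^sup>2 / kerr_S a (r - m) ?\<theta> * kerr_p m a (r - m) ?\<theta>)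
        has_real_derivative
        - (2 * m * a ^ 3 * ?r * (4 * (sin ?\<theta>) ^ 3 * (cos ?\<theta>)\<^sup>2 - (sin ?\<theta>) ^ 5) / (kerr_S a ?r ?\<theta>)\<^sup>2
         + 8 * m * a ^ 5 * ?r * (sin ?\<theta>) ^ 5 * (cos ?\<theta>)\<^sup>2 / (kerr_S a ?r ?\<theta>) ^ 3)) (at (x $ 1))"
    proof (subst DERIV_cong_ev[OF refl _ refl])
      show "\<forall>\<^sub>F r in nhds (x $ 1).
          kerr_A m a (r - m) ?\<theta> * (sin ?\<theta>)\<^sup>2 / kerr_S a (r - m) ?\<theta> * kerr_p m a (r - m) ?\<theta> =
          m * a * (sin ?\<theta>) ^ 3 * kerr_W a (r - m) ?\<theta> / (kerr_S a (r - m) ?\<theta>)\<^sup>2"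
        using r1 by eventually_elim (use Hp in fastforce)
    qed (rule DERIV_shift_diff, rule d)
    show "((\<lambda>\<theta>. kerr_A m a ?r \<theta> * (sin \<theta>)\<^sup>2 / kerr_S a ?r \<theta> * kerr_q m a ?r \<theta>)
        has_real_derivative
        - (- (2 * m * a ^ 3 * ?r * (4 * (sin ?\<theta>) ^ 3 * (cos ?\<theta>)\<^sup>2 - (sin ?\<theta>) ^ 5) / (kerr_S a ?r ?\<theta>)\<^sup>2
         + 8 * m * a ^ 5 * ?r * (sin ?\<theta>) ^ 5 * (cos ?\<theta>)\<^sup>2 / (kerr_S a ?r ?\<theta>) ^ 3))) (at ?\<theta>)"
    proof (subst DERIV_cong_ev[OF refl _ refl])
      show "\<forall>\<^sub>F \<theta> in nhds ?\<theta>.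
          kerr_A m a ?r \<theta> * (sin \<theta>)\<^sup>2 / kerr_S a ?r \<theta> * kerr_q m a ?r \<theta> =
          2 * m * a ^ 3 * ?r * (sin \<theta>) ^ 4 * cos \<theta> / (kerr_S a ?r \<theta>)\<^sup>2"
        using r2 by eventually_elim (use Hq in fastforce)
    qed (rule d)
  qed
qed

end

subsection \<open>The momentum of the Kerr slice\<close>

lemma spatial_simps [simp]: "spatial 1 = 2" "spatial 2 = 3" "spatial 3 = 4"
  by (simp_all add: spatial_def)

lemma event_nth [simp]: "event t x $ 1 = t" "event t x $ 2 = x $ 1" "event t x $ 3 = x $ 2"
    "event t x $ 4 = x $ 3"
  by (simp_all add: event_def vector_def)

lemma vector4_nth [simp]:
  "(vector [p, q, r, s] :: 'a::zero ^ 4) $ 1 = p" "(vector [p, q, r, s] :: 'a ^ 4) $ 2 = q"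
  "(vector [p, q, r, s] :: 'a ^ 4) $ 3 = r" "(vector [p, q, r, s] :: 'a ^ 4) $ 4 = s"
  by (simp_all add: vector_def)

text \<open>The normal covector has only a time component, equal to minus the lapse. Its spatial
  components are identically zero, so only the Christoffel term is left, and the two minus signs
  cancel.\<close>

lemma cov_deriv_unit_normal:
  assumes "i \<noteq> 1" "j \<noteq> 1"
  shows "cov_deriv_covector G (unit_normal G) i j X =
    christoffel G 1 i j X / sqrt (- (inv_metric G X $ 1 $ 1))"
proof -
  have "unit_normal G Y $ j = 0" for Y
    using assms by (simp add: unit_normal_def axis_def)
  then have "partial i (\<lambda>y. unit_normal G y $ j) X = 0"
    by (intro partial_const_on[where U=UNIV]) auto
  then show ?thesis
    by (simp add: cov_deriv_covector_def sum_4 unit_normal_def axis_def)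
qed

text \<open>
  Agreement with Kerr is assumed only where \<open>r > 0\<close>: at \<open>r = 0\<close> the junk values of division make
  \<open>schwarzschild m\<close> and \<open>kerr m 0\<close> differ.
\<close>

locale kerr_spacetime =
  fixes m a :: real and G :: "real ^ 4 \<Rightarrow> real ^ 4 ^ 4"
  assumes G_eq: "\<And>X. X $ 2 > 0 \<Longrightarrow> G X = kerr m a X"
begin

lemma G_nth:
  assumes "X $ 2 > 0"
  shows "G X $ 1 $ 1 = - (1 - 2 * m * X $ 2 / kerr_S a (X $ 2) (X $ 3))"
    "G X $ 1 $ 2 = 0" "G X $ 1 $ 3 = 0"
    "G X $ 1 $ 4 = - (2 * m * a * X $ 2 * (sin (X $ 3))\<^sup>2 / kerr_S a (X $ 2) (X $ 3))"
    "G X $ 2 $ 1 = 0" "G X $ 2 $ 2 = kerr_S a (X $ 2) (X $ 3) / kerr_D m a (X $ 2)"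
    "G X $ 2 $ 3 = 0" "G X $ 2 $ 4 = 0"
    "G X $ 3 $ 1 = 0" "G X $ 3 $ 2 = 0" "G X $ 3 $ 3 = kerr_S a (X $ 2) (X $ 3)" "G X $ 3 $ 4 = 0"
    "G X $ 4 $ 1 = - (2 * m * a * X $ 2 * (sin (X $ 3))\<^sup>2 / kerr_S a (X $ 2) (X $ 3))"
    "G X $ 4 $ 2 = 0" "G X $ 4 $ 3 = 0"
    "G X $ 4 $ 4 = kerr_A m a (X $ 2) (X $ 3) * (sin (X $ 3))\<^sup>2 / kerr_S a (X $ 2) (X $ 3)"
proof -
  have "kerr_S a (X $ 2) (X $ 3) \<noteq> 0"
    using assms by (simp add: kerr_S_def add_pos_nonneg less_imp_neq[symmetric])
  then show "G X $ 4 $ 4 = kerr_A m a (X $ 2) (X $ 3) * (sin (X $ 3))\<^sup>2 / kerr_S a (X $ 2) (X $ 3)"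
    by (simp add: G_eq[OF assms] kerr_def Let_def kerr_A_alt field_simps flip: kerr_S_def)
qed (simp_all add: G_eq[OF assms] kerr_def Let_def kerr_S_def kerr_D_def)

lemma open_exterior: "open {X :: real ^ 4. X $ 2 > 0}"
  by (intro open_Collect_less continuous_intros)

lemma G_partial_14:
  assumes "X $ 2 > 0"
  shows "partial 1 (\<lambda>Y. G Y $ i $ j) X = 0" "partial 4 (\<lambda>Y. G Y $ i $ j) X = 0"
  by (rule partial_eqI[OF open_exterior, where f = "\<lambda>Y. kerr m a Y $ i $ j"];
      use assms in \<open>simp add: G_eq kerr_def axis_def\<close>)+

lemma G_partial_zero:
  assumes "X $ 2 > 0" "(i, j) \<in> {(1, 2), (1, 3), (2, 1), (2, 3), (2, 4), (3, 1), (3, 2), (3, 4), (4, 2), (4, 3)}"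
  shows "partial k (\<lambda>Y. G Y $ i $ j) X = 0"
  by (rule partial_const_on[OF open_exterior, where k = 0]) (use assms G_nth in auto)

lemma partial_4D:
  fixes X :: "real ^ 4"
  assumes "X $ 2 > 0" "\<And>Y :: real ^ 4. Y $ 2 > 0 \<Longrightarrow> F Y = f (Y $ 2) (Y $ 3)"
  shows "((\<lambda>r. f r (X $ 3)) has_real_derivative d) (at (X $ 2)) \<Longrightarrow> partial 2 F X = d"
    "((\<lambda>\<theta>. f (X $ 2) \<theta>) has_real_derivative d) (at (X $ 3)) \<Longrightarrow> partial 3 F X = d"
proof -
  have *: "X \<in> {X. 0 < X $ 2}" "\<And>Y. Y \<in> {X. 0 < X $ 2} \<Longrightarrow> F Y = f (Y $ 2) (Y $ 3)"
    using assms by auto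
  show "partial 2 F X = d" if "((\<lambda>r. f r (X $ 3)) has_real_derivative d) (at (X $ 2))"
    by (rule partial_eqI[OF open_exterior *])
      (use that DERIV_at_within_shift[of "\<lambda>r. f r (X $ 3)" d "X $ 2" 0 UNIV] in \<open>simp_all add: axis_def\<close>)
  show "partial 3 F X = d" if "((\<lambda>\<theta>. f (X $ 2) \<theta>) has_real_derivative d) (at (X $ 3))"
    by (rule partial_eqI[OF open_exterior *])
      (use that DERIV_at_within_shift[of "\<lambda>\<theta>. f (X $ 2) \<theta>" d "X $ 3" 0 UNIV] in \<open>simp_all add: axis_def\<close>)
qed

context
  fixes x :: "real ^ 3" and t r \<theta> S D A s c :: real
  assumes x: "x $ 1 > 0" "x $ 1 \<ge> 2 * \<bar>m\<bar>" "x $ 1 > 2 * m" "0 < x $ 2" "x $ 2 < pi"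
  defines "r \<equiv> x $ 1" and "\<theta> \<equiv> x $ 2"
  defines "S \<equiv> kerr_S a r \<theta>" and "D \<equiv> kerr_D m a r" and "A \<equiv> kerr_A m a r \<theta>"
    and "s \<equiv> sin \<theta>" and "c \<equiv> cos \<theta>"
begin

lemma pos: "r > 0" "S > 0" "D > 0" "A > 0" "s > 0"
  using x kerr_pos[of r m] by (auto simp: r_def \<theta>_def S_def D_def A_def s_def sin_gt_zero)

lemma induced_metric_eq: "induced_metric G t x = diag3 (S / D) S (A * s\<^sup>2 / S)"
  using x(1) by (simp add: vec_eq_iff forall_3 induced_metric_def G_nth r_def \<theta>_def S_def D_def A_def s_def)

lemma inv_metric_row:
  "inv_metric G (event t x) $ 1 $ 1 = - (A / (S * D))" "inv_metric G (event t x) $ 1 $ 2 = 0"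
  "inv_metric G (event t x) $ 1 $ 3 = 0"
  "inv_metric G (event t x) $ 1 $ 4 = - (2 * m * a * r / (S * D))"
proof -
  \<comment> \<open>Block inverse: the r and \<theta> entries are inverted directly, and the (t,
    \<phi>) block has determinant -D s^2.\<close>
  define I :: "real ^ 4 ^ 4" where "I = vector
    [vector [- (A / (S * D)), 0, 0, - (2 * m * a * r / (S * D))],
     vector [0, D / S, 0, 0],
     vector [0, 0, 1 / S, 0],
     vector [- (2 * m * a * r / (S * D)), 0, 0, (D - a\<^sup>2 * s\<^sup>2) / (S * D * s\<^sup>2)]]"
  have D: "D - a\<^sup>2 * s\<^sup>2 = S - 2 * m * r"
    by (simp add: D_def S_def s_def kerr_D_def kerr_S_def cos_squared_eq algebra_simps)
  \<comment> \<open>This is the determinant of the (t, \<phi>) block with its denominator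
    cleared.\<close>
  have "(S - 2 * m * r) * A + 4 * m\<^sup>2 * a\<^sup>2 * r\<^sup>2 * s\<^sup>2 = S\<^sup>2 * D"
    unfolding A_def S_def D_def kerr_A_def kerr_S_def kerr_D_def cos_squared_eq s_def by algebra
  then have id: "A * S + 4 * m\<^sup>2 * a\<^sup>2 * r\<^sup>2 * s\<^sup>2 = S\<^sup>2 * D + 2 * m * r * A"
    by (simp add: algebra_simps)
  have "G (event t x) ** I = mat 1"
    using x(1) pos unfolding vec_eq_iff forall_4 matrix_matrix_mult_def
    by (simp add: sum_4 G_nth mat_def I_def D flip: r_def \<theta>_def S_def D_def A_def s_def,
        simp add: field_simps power2_eq_square)
      (use id in algebra)
  then have I: "inv_metric G (event t x) = I"
    unfolding inv_metric_def by (rule matrix_inv_eqI)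
  show "inv_metric G (event t x) $ 1 $ 1 = - (A / (S * D))" "inv_metric G (event t x) $ 1 $ 2 = 0"
    "inv_metric G (event t x) $ 1 $ 3 = 0"
    "inv_metric G (event t x) $ 1 $ 4 = - (2 * m * a * r / (S * D))"
    by (simp_all add: I I_def)
qed

lemma G_partial_2:
  "partial 2 (\<lambda>Y. G Y $ 1 $ 4) (event t x) = - (2 * m * a * s\<^sup>2 * (S - 2 * r\<^sup>2) / S\<^sup>2)"
  "partial 2 (\<lambda>Y. G Y $ 4 $ 4) (event t x) = 2 * (A * s\<^sup>2 / S) * kerr_\<gamma>1 m a r \<theta>"
proof -
  have "((\<lambda>r. - (2 * m * a * r * s\<^sup>2 / kerr_S a r \<theta>)) has_real_derivative
     - (2 * m * a * s\<^sup>2 * (S - 2 * r\<^sup>2) / S\<^sup>2)) (at r)"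
    using pos unfolding S_def
    by (auto intro!: derivative_eq_intros kerr_S_deriv simp: field_simps power2_eq_square)
  then show "partial 2 (\<lambda>Y. G Y $ 1 $ 4) (event t x) = - (2 * m * a * s\<^sup>2 * (S - 2 * r\<^sup>2) / S\<^sup>2)"
    using x(1)
    by (intro partial_4D(1)[where f = "\<lambda>r \<theta>. - (2 * m * a * r * (sin \<theta>)\<^sup>2 / kerr_S a r \<theta>)"])
      (simp_all add: G_nth r_def \<theta>_def s_def)
  show "partial 2 (\<lambda>Y. G Y $ 4 $ 4) (event t x) = 2 * (A * s\<^sup>2 / S) * kerr_\<gamma>1 m a r \<theta>"
    using x(1) kerr_log_deriv_r(3)[of a r \<theta> m] pos
    by (intro partial_4D(1)[where f = "\<lambda>r \<theta>. kerr_A m a r \<theta> * (sin \<theta>)\<^sup>2 / kerr_S a r \<theta>"])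
      (simp_all add: G_nth r_def \<theta>_def s_def A_def S_def D_def)
qed

lemma G_partial_3:
  "partial 3 (\<lambda>Y. G Y $ 1 $ 4) (event t x) =
    - (4 * m * a * r * (s * c / S + a\<^sup>2 * s ^ 3 * c / S\<^sup>2))"
  "partial 3 (\<lambda>Y. G Y $ 4 $ 4) (event t x) = 2 * (A * s\<^sup>2 / S) * kerr_\<gamma>2 m a r \<theta>"
proof -
  have "((\<lambda>\<theta>. - (2 * m * a * r * (sin \<theta>)\<^sup>2 / kerr_S a r \<theta>)) has_real_derivative
     - (4 * m * a * r * (s * c / S + a\<^sup>2 * s ^ 3 * c / S\<^sup>2))) (at \<theta>)"
    using pos unfolding S_def s_def c_def
    by (auto intro!: derivative_eq_intros kerr_S_deriv simp: field_simps power2_eq_square power3_eq_cube)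
  then show "partial 3 (\<lambda>Y. G Y $ 1 $ 4) (event t x) =
      - (4 * m * a * r * (s * c / S + a\<^sup>2 * s ^ 3 * c / S\<^sup>2))"
    using x(1)
    by (intro partial_4D(2)[where f = "\<lambda>r \<theta>. - (2 * m * a * r * (sin \<theta>)\<^sup>2 / kerr_S a r \<theta>)"])
      (simp_all add: G_nth r_def \<theta>_def)
  show "partial 3 (\<lambda>Y. G Y $ 4 $ 4) (event t x) = 2 * (A * s\<^sup>2 / S) * kerr_\<gamma>2 m a r \<theta>"
    using x(1) kerr_log_deriv_th(3)[of a r \<theta> m] pos
    by (intro partial_4D(2)[where f = "\<lambda>r \<theta>. kerr_A m a r \<theta> * (sin \<theta>)\<^sup>2 / kerr_S a r \<theta>"])
      (simp_all add: G_nth r_def \<theta>_def s_def A_def S_def D_def)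
qed

text \<open>The metric is independent of t and \<phi>, so for i = r, \<theta> the symbol is half of
  g^tt times the i-derivative of g_t\<phi> plus g^t\<phi> times that of g_\<phi>\<phi>. The radial
  one produces \<open>kerr_W\<close> through A - r Ar.\<close>

lemma christoffel_time:
  "christoffel G 1 2 4 (event t x) = m * a * s\<^sup>2 * kerr_W a r \<theta> / (S\<^sup>2 * D)"
  "christoffel G 1 4 2 (event t x) = m * a * s\<^sup>2 * kerr_W a r \<theta> / (S\<^sup>2 * D)"
  "christoffel G 1 3 4 (event t x) = 2 * m * a ^ 3 * r * s ^ 3 * c / S\<^sup>2"
  "christoffel G 1 4 3 (event t x) = 2 * m * a ^ 3 * r * s ^ 3 * c / S\<^sup>2"
  "christoffel G 1 2 2 (event t x) = 0" "christoffel G 1 2 3 (event t x) = 0"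
  "christoffel G 1 3 2 (event t x) = 0" "christoffel G 1 3 3 (event t x) = 0"
  "christoffel G 1 4 4 (event t x) = 0"
proof -
  have ev: "event t x $ 2 > 0"
    using x by simp
  note P = inv_metric_row G_partial_14[OF ev] G_partial_zero[OF ev] G_partial_2 G_partial_3
  have W: "kerr_W a r \<theta> = A - r * kerr_Ar m a r \<theta>"
    by (simp add: A_def kerr_W_eq)
  have "1 / 2 * (- (A / (S * D)) * - (2 * m * a * s\<^sup>2 * (S - 2 * r\<^sup>2) / S\<^sup>2)
      + - (2 * m * a * r / (S * D)) * (2 * (A * s\<^sup>2 / S) * kerr_\<gamma>1 m a r \<theta>))
    = m * a * s\<^sup>2 * kerr_W a r \<theta> / (S\<^sup>2 * D)"
    unfolding W kerr_\<gamma>1_def A_def[symmetric] S_def[symmetric]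
    using pos by (simp add: field_simps power2_eq_square)
  then show "christoffel G 1 2 4 (event t x) = m * a * s\<^sup>2 * kerr_W a r \<theta> / (S\<^sup>2 * D)"
    "christoffel G 1 4 2 (event t x) = m * a * s\<^sup>2 * kerr_W a r \<theta> / (S\<^sup>2 * D)"
    by (simp_all add: christoffel_def sum_4 P)
  have "1 / 2 * (- (A / (S * D)) * - (4 * m * a * r * (s * c / S + a\<^sup>2 * s ^ 3 * c / S\<^sup>2))
      + - (2 * m * a * r / (S * D)) * (2 * (A * s\<^sup>2 / S) * kerr_\<gamma>2 m a r \<theta>))
    = 2 * m * a ^ 3 * r * s ^ 3 * c / S\<^sup>2"
    unfolding kerr_\<gamma>2_def A_def[symmetric] S_def[symmetric] D_def[symmetric] s_def[symmetric] c_def[symmetric]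
    using pos by (simp add: field_simps power2_eq_square power3_eq_cube)
  then show "christoffel G 1 3 4 (event t x) = 2 * m * a ^ 3 * r * s ^ 3 * c / S\<^sup>2"
    "christoffel G 1 4 3 (event t x) = 2 * m * a ^ 3 * r * s ^ 3 * c / S\<^sup>2"
    by (simp_all add: christoffel_def sum_4 P)
qed (use x in \<open>simp_all add: christoffel_def sum_4 inv_metric_row G_partial_14 G_partial_zero\<close>)

lemma adm_momentum_eq:
  "adm_momentum G t x = offdiag3 (kerr_p m a r \<theta>) (kerr_q m a r \<theta>)"
proof -
  \<comment> \<open>\<open>N\<close> is the reciprocal of the lapse; \<open>k1\<close> and
    \<open>k2\<close> are the two nonzero time Christoffel symbols.\<close>
  define N where "N = sqrt (A / (S * D))"
  define k1 where "k1 = m * a * s\<^sup>2 * kerr_W a r \<theta> / (S\<^sup>2 * D)"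
  define k2 where "k2 = 2 * m * a ^ 3 * r * s ^ 3 * c / S\<^sup>2"
  have K: "extrinsic_curvature G t x = offdiag3 (k1 / N) (k2 / N)"
    by (simp add: vec_eq_iff forall_3 extrinsic_curvature_def cov_deriv_unit_normal christoffel_time
        inv_metric_row N_def k1_def k2_def)
  have h: "inv_metric (induced_metric G t) x = diag3 (D / S) (1 / S) (S / (A * s\<^sup>2))"
    using pos by (simp add: inv_metric_def induced_metric_eq matrix_inv_diag3)
  \<comment> \<open>The determinant is split as \<open>N\<close> squared times (S s)^2, so the
    factor \<open>N\<close> from its root cancels the one dividing K, and no square root survives.
    The trace of K is zero by its shape.\<close>
  have "det (induced_metric G t x) = A / (S * D) * (S * s)\<^sup>2"
    using pos by (simp add: induced_metric_eq det_diag3 field_simps power2_eq_square)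
  then have "sqrt (det (induced_metric G t x)) = N * sqrt ((S * s)\<^sup>2)"
    unfolding N_def by (simp only: real_sqrt_mult)
  then have det: "sqrt (det (induced_metric G t x)) = N * (S * s)"
    using pos by simp
  have N: "N > 0"
    using pos by (simp add: N_def)
  have p: "kerr_p m a r \<theta> = S * s * (D / S * (S / (A * s\<^sup>2)) * k1)"
    and q: "kerr_q m a r \<theta> = S * s * (1 / S * (S / (A * s\<^sup>2)) * k2)"
    unfolding kerr_p_def kerr_q_def k1_def k2_def
      A_def[symmetric] S_def[symmetric] s_def[symmetric] c_def[symmetric]
    using pos by (simp_all add: field_simps power2_eq_square power3_eq_cube)
  show ?thesis
    unfolding adm_momentum_def Let_def K h det p q
    using N by (simp add: vec_eq_iff forall_3 sum_3 matrix_matrix_mult_def)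
qed

end

section \<open>Passing to the radial coordinate r'\<close>

text \<open>The assumption puts x $ 1 - m into the positive half-line to which
  \<open>inv_into\<close> is confined; there \<open>new_radius m\<close> is r + m, hence
  injective.\<close>

lemma old_coords_eq:
  assumes "x $ 1 > m"
  shows "old_coords m x = x - m *\<^sub>R axis 1 1"
proof -
  have inj: "inj_on (new_radius m) {0<..}"
    by (auto simp: inj_on_def new_radius_def distrib_left)
  have "inv_into {0<..} (new_radius m) (new_radius m (x $ 1 - m)) = x $ 1 - m"
    by (rule inv_into_f_f[OF inj]) (use assms in simp)
  moreover have "new_radius m (x $ 1 - m) = x $ 1"
    using assms by (simp add: new_radius_def field_simps)
  ultimately show ?thesis
    by (simp add: old_coords_def vec_eq_iff forall_3 axis_def)
qed

lemma jacobian_old_coords: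
  assumes "x $ 1 > m"
  shows "jacobian (old_coords m) x = mat 1"
proof -
  have op: "open {x :: real ^ 3. x $ 1 > m}"
    by (intro open_Collect_less continuous_intros)
  have "partial i (\<lambda>z. old_coords m z $ k) x = mat 1 $ k $ i" for k i
    by (rule partial_eqI[OF op, where f = "\<lambda>z. z $ k - (if k = 1 then m else 0)"])
      (use assms in \<open>auto simp: old_coords_eq axis_def mat_def intro!: derivative_eq_intros\<close>)
  then show ?thesis
    by (simp add: vec_eq_iff jacobian_def)
qed

lemma transform_old_coords:
  assumes "x $ 1 > m"
  shows "transform_metric (old_coords m) g x = g (x - m *\<^sub>R axis 1 1)"
    "transform_momentum (old_coords m) P x = P (x - m *\<^sub>R axis 1 1)"
proof -
  have "matrix_inv (mat 1 :: real ^ 3 ^ 3) = mat 1"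
    by (rule matrix_inv_eqI) simp
  then show "transform_metric (old_coords m) g x = g (x - m *\<^sub>R axis 1 1)"
    "transform_momentum (old_coords m) P x = P (x - m *\<^sub>R axis 1 1)"
    using assms
    by (simp_all add: transform_metric_def transform_momentum_def jacobian_old_coords old_coords_eq
        transpose_mat)
qed

lemma kerr_slice_old_coords:
  "kerr_slice m a (transform_metric (old_coords m) (induced_metric G t))
    (transform_momentum (old_coords m) (adm_momentum G t))"
proof
  fix x assume x: "x \<in> kerr_region m"
  let ?y = "x - m *\<^sub>R axis 1 1"
  have m: "x $ 1 > m"
    using x by (auto simp: kerr_region_def)
  have y: "?y $ 1 > 0" "?y $ 1 \<ge> 2 * \<bar>m\<bar>" "?y $ 1 > 2 * m" "0 < ?y $ 2" "?y $ 2 < pi"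
    using x by (auto simp: kerr_region_def axis_def)
  show "transform_metric (old_coords m) (induced_metric G t) x =
      diag3 (kerr_S a (x $ 1 - m) (x $ 2) / kerr_D m a (x $ 1 - m)) (kerr_S a (x $ 1 - m) (x $ 2))
        (kerr_A m a (x $ 1 - m) (x $ 2) * (sin (x $ 2))\<^sup>2 / kerr_S a (x $ 1 - m) (x $ 2))"
    using induced_metric_eq[OF y] by (simp add: transform_old_coords[OF m] axis_def)
  show "transform_momentum (old_coords m) (adm_momentum G t) x =
      offdiag3 (kerr_p m a (x $ 1 - m) (x $ 2)) (kerr_q m a (x $ 1 - m) (x $ 2))"
    using adm_momentum_eq[OF y] by (simp add: transform_old_coords[OF m] axis_def)
qed

end

subsection \<open>Asymptotics\<close>

lemma unif_oI:
  fixes G :: "real \<Rightarrow> real \<Rightarrow> real"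
  assumes \<delta>: "\<delta> > 0" and cont: "continuous_on ({0..\<delta>} \<times> {0..pi}) (\<lambda>z. G (fst z) (snd z))"
    and zero: "\<And>\<theta>. G 0 \<theta> = 0"
    and F: "\<And>x \<theta> \<phi>. 0 < x \<Longrightarrow> x \<le> \<delta> \<Longrightarrow> 0 < \<theta> \<Longrightarrow> \<theta> < pi \<Longrightarrow>
      F (1 / x) \<theta> \<phi> = x ^ k * G x \<theta>"
  shows "unif_o k F"
  unfolding unif_o_def uniform_limit_iff
proof (intro allI impI)
  fix e :: real assume "e > 0"
  have "uniformly_continuous_on ({0..\<delta>} \<times> {0..pi}) (\<lambda>z. G (fst z) (snd z))"
    by (intro compact_uniformly_continuous cont compact_Times compact_Icc)
  then obtain d where d: "d > 0" and G: "\<And>z w. z \<in> {0..\<delta>} \<times> {0..pi} \<Longrightarrow> w \<in> {0..\<delta>} \<times> {0..pi} \<Longrightarrow>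
      dist w z < d \<Longrightarrow> dist (G (fst w) (snd w)) (G (fst z) (snd z)) < e"
    unfolding uniformly_continuous_on_def using \<open>e > 0\<close> by metis
  have "\<forall>\<^sub>F r in at_top. r > max (1 / \<delta>) (1 / d)"
    by (rule eventually_gt_at_top)
  then show "\<forall>\<^sub>F r in at_top. \<forall>z\<in>sphere_chart.
      dist (case z of (\<theta>, \<phi>) \<Rightarrow> r ^ k * F r \<theta> \<phi>) 0 < e"
  proof eventually_elim
    case (elim r)
    define x where "x = 1 / r"
    have "r > 0"
      using elim \<delta> by (auto intro: less_trans[of 0 "1 / \<delta>"])
    then have x: "0 < x" "x \<le> \<delta>" "x < d" and r: "r = 1 / x"
      using elim \<delta> d by (auto simp: x_def field_simps)
    have "\<bar>r ^ k * F r \<theta> \<phi>\<bar> < e" if "0 < \<theta>" "\<theta> < pi" for \<theta> \<phi>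
    proof -
      have "r ^ k * F r \<theta> \<phi> = G x \<theta>"
        unfolding r F[OF x(1,2) that] using x(1) by (simp add: power_divide)
      \<comment> \<open>Uniform continuity is used between (x, \<theta>) and the point at infinity
        with the same angle, so their distance is just x.\<close>
      moreover have "dist (G x \<theta>) (G 0 \<theta>) < e"
        using G[of "(0, \<theta>)" "(x, \<theta>)"] x \<delta> that by (simp add: dist_Pair_Pair)
      ultimately show ?thesis
        by (simp add: zero)
    qed
    then show ?case
      by (auto simp: sphere_chart_def)
  qed
qed

text \<open>
  Homogeneity turns each Kerr function at \<open>1 / x - m\<close> into a power of \<open>x\<close> times a function that
  extends continuously to \<open>x = 0\<close>.
\<close>

lemma kerr_scale:
  "kerr_S (x * a) (x * r) \<theta> = x\<^sup>2 * kerr_S a r \<theta>"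
  "kerr_D (x * m) (x * a) (x * r) = x\<^sup>2 * kerr_D m a r"
  "kerr_A (x * m) (x * a) (x * r) \<theta> = x ^ 4 * kerr_A m a r \<theta>"
  "kerr_W (x * a) (x * r) \<theta> = x ^ 4 * kerr_W a r \<theta>"
proof -
  show S: "kerr_S (x * a) (x * r) \<theta> = x\<^sup>2 * kerr_S a r \<theta>"
    by (simp add: kerr_S_def algebra_simps power2_eq_square)
  show "kerr_D (x * m) (x * a) (x * r) = x\<^sup>2 * kerr_D m a r"
    by (simp add: kerr_D_def algebra_simps power2_eq_square)
  show "kerr_A (x * m) (x * a) (x * r) \<theta> = x ^ 4 * kerr_A m a r \<theta>"
    unfolding kerr_A_alt S by (simp add: algebra_simps power2_eq_square power4_eq_xxxx)
  show "kerr_W (x * a) (x * r) \<theta> = x ^ 4 * kerr_W a r \<theta>"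
    unfolding kerr_W_def by (simp add: algebra_simps power2_eq_square power4_eq_xxxx)
qed

lemma kerr_scale_inverse:
  fixes x m a :: real
  assumes "x > 0"
  shows
  "kerr_S a (1 / x - m) \<theta> = kerr_S (x * a) (1 - x * m) \<theta> / x\<^sup>2"
  "kerr_D m a (1 / x - m) = kerr_D (x * m) (x * a) (1 - x * m) / x\<^sup>2"
  "kerr_A m a (1 / x - m) \<theta> = kerr_A (x * m) (x * a) (1 - x * m) \<theta> / x ^ 4"
  "kerr_W a (1 / x - m) \<theta> = kerr_W (x * a) (1 - x * m) \<theta> / x ^ 4"
proof -
  have "1 - x * m = x * (1 / x - m)"
    using assms by (simp add: right_diff_distrib)
  then show "kerr_S a (1 / x - m) \<theta> = kerr_S (x * a) (1 - x * m) \<theta> / x\<^sup>2"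
    "kerr_D m a (1 / x - m) = kerr_D (x * m) (x * a) (1 - x * m) / x\<^sup>2"
    "kerr_A m a (1 / x - m) \<theta> = kerr_A (x * m) (x * a) (1 - x * m) \<theta> / x ^ 4"
    "kerr_W a (1 / x - m) \<theta> = kerr_W (x * a) (1 - x * m) \<theta> / x ^ 4"
    using assms by (simp_all only: kerr_scale) simp_all
qed

text \<open>The scaled mass x m and radius 1 - x m satisfy the hypotheses of
  \<open>kerr_pos\<close>, including x = 0, where the radius is 1 and the mass 0. The added 1 in the
  bound keeps it finite for m = 0 and makes 3 |x m| < 1 strict.\<close>

lemma kerr_scaled_pos:
  fixes x m a :: real
  assumes "0 \<le> x" "x \<le> 1 / (3 * \<bar>m\<bar> + 1)"
  shows "kerr_S (x * a) (1 - x * m) \<theta> > 0" "kerr_D (x * m) (x * a) (1 - x * m) > 0"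
    "kerr_A (x * m) (x * a) (1 - x * m) \<theta> > 0"
proof -
  have "x * (3 * \<bar>m\<bar> + 1) \<le> 1"
    using assms(2) by (simp add: pos_le_divide_eq add_nonneg_pos)
  then have "3 * \<bar>x * m\<bar> + x \<le> 1"
    using assms(1) by (simp add: abs_mult algebra_simps)
  moreover have "3 * \<bar>x * m\<bar> < 1"
    using calculation assms(1) by (cases "x = 0") auto
  ultimately have "1 - x * m > 0" "1 - x * m \<ge> 2 * \<bar>x * m\<bar>" "1 - x * m > 2 * (x * m)"
    by linarith+
  then show "kerr_S (x * a) (1 - x * m) \<theta> > 0" "kerr_D (x * m) (x * a) (1 - x * m) > 0"
    "kerr_A (x * m) (x * a) (1 - x * m) \<theta> > 0"
    using kerr_pos by blast+
qed

lemma continuous_on_kerr [continuous_intros]: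
  fixes X :: "'a::t2_space set"
  assumes "continuous_on X f" "continuous_on X g" "continuous_on X h" "continuous_on X l"
  shows "continuous_on X (\<lambda>z. kerr_S (f z) (g z) (h z))"
    "continuous_on X (\<lambda>z. kerr_D (f z) (g z) (h z))"
    "continuous_on X (\<lambda>z. kerr_A (f z) (g z) (h z) (l z))"
    "continuous_on X (\<lambda>z. kerr_W (f z) (g z) (h z))"
  unfolding kerr_S_def kerr_D_def kerr_A_def kerr_W_def
  by (auto intro!: continuous_intros assms)

section \<open>Expansion coefficients and fall-off of the Kerr data\<close>

text \<open>Obtained by inserting r = r' - m. In \<open>h2_rr\<close>, 4 m^2 comes from expanding S
  / D in r and 2 m^2 from 2 m / r = 2 m / r' + 2 m^2 / r'^2 + ...; \<open>h1_AB\<close> is the cross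
  term of (r' - m)^2.\<close>

definition kerr_coeffs :: "real \<Rightarrow> real \<Rightarrow> bc_coeffs" where
  "kerr_coeffs m a = \<lparr>
     h1_rr = \<lambda>_ _. 2 * m,
     h2_rr = \<lambda>\<theta> _. 6 * m\<^sup>2 - a\<^sup>2 * (sin \<theta>)\<^sup>2,
     h2_rA = \<lambda>_ _ _. 0,
     h1_AB = \<lambda>A B \<theta> \<phi>. - 2 * m * round_metric A B \<theta> \<phi>,
     h2_AB = \<lambda>A B \<theta> \<phi>.
       (m\<^sup>2 + a\<^sup>2 * (if A = 1 then (cos \<theta>)\<^sup>2 else 1)) * round_metric A B \<theta> \<phi>,
     p1_rr = \<lambda>_ _. 0,
     p2_rr = \<lambda>_ _. 0,
     p1_rA = \<lambda>_ _ _. 0,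
     p2_rA = \<lambda>A \<theta> _. if A = 2 then - 3 * m * a * sin \<theta> else 0,
     p1_AB = \<lambda>_ _ _ _. 0,
     p2_AB = \<lambda>_ _ _ _. 0\<rparr>"

lemma ang_simps [simp]: "ang 1 = 2" "ang 2 = 3"
  by (simp_all add: ang_def)

lemma pt_nth [simp]: "pt r \<theta> \<phi> $ 1 = r" "pt r \<theta> \<phi> $ 2 = \<theta>" "pt r \<theta> \<phi> $ 3 = \<phi>"
  by (simp_all add: pt_def)

lemma pt_in_kerr_region:
  assumes "0 < x" "x \<le> 1 / (3 * \<bar>m\<bar> + 1)" "0 < \<theta>" "\<theta> < pi"
  shows "pt (1 / x) \<theta> \<phi> \<in> kerr_region m"
proof -
  have "x * (3 * \<bar>m\<bar> + 1) \<le> 1"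
    using assms(2) by (simp add: pos_le_divide_eq add_nonneg_pos)
  then have "3 * \<bar>m\<bar> < 1 / x"
    using assms(1) by (simp add: field_simps)
  then show ?thesis
    using assms by (simp add: kerr_region_def)
qed

context kerr_slice
begin

definition \<delta> :: real where "\<delta> = 1 / (3 * \<bar>m\<bar> + 1)"

lemma \<delta>_pos: "\<delta> > 0"
  by (simp add: \<delta>_def add_nonneg_pos)

lemma pt_in_region:
  assumes "0 < x" "x \<le> \<delta>" "0 < \<theta>" "\<theta> < pi"
  shows "pt (1 / x) \<theta> \<phi> \<in> kerr_region m"
  using assms pt_in_kerr_region by (simp add: \<delta>_def)

lemma unif_o_zeroI:
  assumes "\<And>x \<theta> \<phi>. pt x \<theta> \<phi> \<in> kerr_region m \<Longrightarrow> F x \<theta> \<phi> = 0"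
  shows "unif_o k F"
  by (rule unif_oI[OF \<delta>_pos, where G = "\<lambda>_ _. 0"])
    (use assms pt_in_region in auto)

lemma constraint_falloff: "constraint_falloff g P"
  unfolding constraint_falloff_def
  by (auto intro!: unif_o_zeroI simp: hamiltonian_constraint_zero momentum_constraint_zero)

lemma metric_falloff: "metric_falloff (kerr_coeffs m a) g"
  unfolding metric_falloff_def
proof (intro conjI allI)
  define k where "k \<theta> = 6 * m\<^sup>2 - a\<^sup>2 * (sin \<theta>)\<^sup>2" for \<theta>
  \<comment> \<open>The scaled D is 1 - 4 m x + (3 m^2 + a^2) x^2. Its product with 1 + 2 m x + k
    x^2 agrees with the scaled S through order x^2, and \<open>N\<close> collects the cubic and
    quartic terms.\<close>
  define N where "N x \<theta> = 2 * m * (3 * m\<^sup>2 + a\<^sup>2) - 4 * m * k \<theta> + x * k \<theta> * (3 * m\<^sup>2 + a\<^sup>2)" for x \<theta>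
  show "unif_o 2 (\<lambda>r \<theta> \<phi>. g (pt r \<theta> \<phi>) $ 1 $ 1 -
      (1 + h1_rr (kerr_coeffs m a) \<theta> \<phi> / r + h2_rr (kerr_coeffs m a) \<theta> \<phi> / r\<^sup>2))"
  proof (rule unif_oI[OF \<delta>_pos, where G = "\<lambda>x \<theta>. - (x * N x \<theta> / kerr_D (x * m) (x * a) (1 - x * m))"])
    show "continuous_on ({0..\<delta>} \<times> {0..pi})
        (\<lambda>z. - (fst z * N (fst z) (snd z) / kerr_D (fst z * m) (fst z * a) (1 - fst z * m)))"
      unfolding N_def k_def
      by (intro continuous_intros) (auto simp: \<delta>_def less_imp_neq[OF kerr_scaled_pos(2), symmetric])
    fix x \<theta> \<phi> assume x: "0 < x" "x \<le> \<delta>" "0 < \<theta>" "\<theta> < pi"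
    let ?D = "kerr_D (x * m) (x * a) (1 - x * m)" and ?S = "kerr_S (x * a) (1 - x * m) \<theta>"
    have D: "?D > 0"
      using x kerr_scaled_pos by (simp add: \<delta>_def)
    have "?S - ?D * (1 + 2 * m * x + k \<theta> * x\<^sup>2) = - (x ^ 3 * N x \<theta>)"
      unfolding kerr_S_def kerr_D_def N_def k_def cos_squared_eq by algebra
    then have "?S = ?D * (1 + 2 * m * x + k \<theta> * x\<^sup>2) - x ^ 3 * N x \<theta>"
      by linarith
    then have "?S / ?D - (1 + 2 * m * x + k \<theta> * x\<^sup>2) = x\<^sup>2 * - (x * N x \<theta> / ?D)"
      using D by (simp add: diff_divide_distrib power2_eq_square power3_eq_cube)
    then show "g (pt (1 / x) \<theta> \<phi>) $ 1 $ 1 - (1 + h1_rr (kerr_coeffs m a) \<theta> \<phi> / (1 / x) +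
        h2_rr (kerr_coeffs m a) \<theta> \<phi> / (1 / x)\<^sup>2) = x\<^sup>2 * - (x * N x \<theta> / ?D)"
      using x by (simp add: metric pt_in_region kerr_scale_inverse kerr_coeffs_def
          k_def power_divide)
  qed simp
next
  fix A
  show "unif_o 1 (\<lambda>r \<theta> \<phi>. (g (pt r \<theta> \<phi>) $ 1 $ ang A - h2_rA (kerr_coeffs m a) A \<theta> \<phi> / r) / frame A \<theta>)"
    by (rule unif_o_zeroI) (use exhaust_2[of A] in \<open>auto simp: metric kerr_coeffs_def\<close>)
next
  fix A B
  \<comment> \<open>Among the angular components only this one has a remainder: after division by
    sin^2, \<open>kerr_A_alt\<close> matches all listed orders exactly and leaves 2 m a^2 r sin^2
    \<theta> / S, of order 1 / r.\<close>
  have 33: "unif_o 0 (\<lambda>r \<theta> \<phi>. (g (pt r \<theta> \<phi>) $ 3 $ 3 - (r\<^sup>2 * (sin \<theta>)\<^sup>2 + r * (- 2 * m * (sin \<theta>)\<^sup>2)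
      + (m\<^sup>2 + a\<^sup>2) * (sin \<theta>)\<^sup>2)) / (sin \<theta> * sin \<theta>))"
  proof (rule unif_oI[OF \<delta>_pos, where G = "\<lambda>x \<theta>. x * (2 * m * a\<^sup>2 * (1 - x * m) * (sin \<theta>)\<^sup>2 / kerr_S (x * a) (1 - x * m) \<theta>)"])
    show "continuous_on ({0..\<delta>} \<times> {0..pi}) (\<lambda>z. fst z * (2 * m * a\<^sup>2 * (1 - fst z * m) * (sin (snd z))\<^sup>2
        / kerr_S (fst z * a) (1 - fst z * m) (snd z)))"
      by (intro continuous_intros) (auto simp: \<delta>_def less_imp_neq[OF kerr_scaled_pos(1), symmetric])
    fix x \<theta> \<phi> assume x: "0 < x" "x \<le> \<delta>" "0 < \<theta>" "\<theta> < pi"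
    have S: "kerr_S (x * a) (1 - x * m) \<theta> > 0"
      using x kerr_scaled_pos by (simp add: \<delta>_def)
    have s: "sin \<theta> > 0"
      using x by (simp add: sin_gt_zero)
    have "kerr_A m a (1 / x - m) \<theta> / kerr_S a (1 / x - m) \<theta> = (1 / x - m)\<^sup>2 + a\<^sup>2
        + 2 * m * a\<^sup>2 * (1 / x - m) * (sin \<theta>)\<^sup>2 / kerr_S a (1 / x - m) \<theta>"
    proof -
      have "kerr_S a (1 / x - m) \<theta> > 0"
        using S x by (simp add: kerr_scale_inverse)
      then show ?thesis
        unfolding kerr_A_alt by (simp add: add_divide_distrib)
    qed
    also have "2 * m * a\<^sup>2 * (1 / x - m) * (sin \<theta>)\<^sup>2 / kerr_S a (1 / x - m) \<theta>
        = x * (2 * m * a\<^sup>2 * (1 - x * m) * (sin \<theta>)\<^sup>2 / kerr_S (x * a) (1 - x * m) \<theta>)"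
      unfolding kerr_scale_inverse[OF x(1)] using S x by (simp add: field_simps power2_eq_square)
    finally have "kerr_A m a (1 / x - m) \<theta> / kerr_S a (1 / x - m) \<theta>
        - ((1 / x)\<^sup>2 + (1 / x) * (- 2 * m) + (m\<^sup>2 + a\<^sup>2))
        = x * (2 * m * a\<^sup>2 * (1 - x * m) * (sin \<theta>)\<^sup>2 / kerr_S (x * a) (1 - x * m) \<theta>)"
      by (simp add: power2_diff)
    moreover have "(Q * (sin \<theta>)\<^sup>2 / T - ((1 / x)\<^sup>2 * (sin \<theta>)\<^sup>2 + 1 / x * (- 2 * m * (sin \<theta>)\<^sup>2)
        + (m\<^sup>2 + a\<^sup>2) * (sin \<theta>)\<^sup>2)) / (sin \<theta> * sin \<theta>)
      = Q / T - ((1 / x)\<^sup>2 + (1 / x) * (- 2 * m) + (m\<^sup>2 + a\<^sup>2))" for Q T :: real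
    proof -
      have "Q * (sin \<theta>)\<^sup>2 / T - ((1 / x)\<^sup>2 * (sin \<theta>)\<^sup>2 + 1 / x * (- 2 * m * (sin \<theta>)\<^sup>2)
          + (m\<^sup>2 + a\<^sup>2) * (sin \<theta>)\<^sup>2)
        = (Q / T - ((1 / x)\<^sup>2 + (1 / x) * (- 2 * m) + (m\<^sup>2 + a\<^sup>2))) * (sin \<theta> * sin \<theta>)"
        by (simp add: algebra_simps power2_eq_square)
      then show ?thesis
        using s by simp
    qed
    ultimately show "(g (pt (1 / x) \<theta> \<phi>) $ 3 $ 3 - ((1 / x)\<^sup>2 * (sin \<theta>)\<^sup>2 + 1 / x * (- 2 * m * (sin \<theta>)\<^sup>2)
        + (m\<^sup>2 + a\<^sup>2) * (sin \<theta>)\<^sup>2)) / (sin \<theta> * sin \<theta>)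
      = x ^ 0 * (x * (2 * m * a\<^sup>2 * (1 - x * m) * (sin \<theta>)\<^sup>2 / kerr_S (x * a) (1 - x * m) \<theta>))"
      using x by (simp only: metric pt_in_region diag3_nth pt_nth power_0 mult_1)
  qed simp
  show "unif_o 0 (\<lambda>r \<theta> \<phi>. (g (pt r \<theta> \<phi>) $ ang A $ ang B - (r\<^sup>2 * round_metric A B \<theta> \<phi> +
      r * h1_AB (kerr_coeffs m a) A B \<theta> \<phi> + h2_AB (kerr_coeffs m a) A B \<theta> \<phi>)) / (frame A \<theta> * frame B \<theta>))"
  proof (cases "A = 2 \<and> B = 2")
    case True
    then show ?thesis
      using 33 by (simp add: kerr_coeffs_def round_metric_def frame_def)
  next
    case False
    then consider "A = 1" "B = 1" | "A = 1" "B = 2" | "A = 2" "B = 1"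
      using exhaust_2 by metis
    then show ?thesis
      by cases (rule unif_o_zeroI,
          simp add: metric kerr_coeffs_def round_metric_def kerr_S_def power2_eq_square algebra_simps)+
  qed
qed

lemma momentum_falloff: "momentum_falloff (kerr_coeffs m a) P"
  unfolding momentum_falloff_def
proof (intro conjI allI)
  show "unif_o 1 (\<lambda>r \<theta> \<phi>. (P (pt r \<theta> \<phi>) $ 1 $ 1 -
      (p1_rr (kerr_coeffs m a) \<theta> \<phi> + p2_rr (kerr_coeffs m a) \<theta> \<phi> / r)) / sin \<theta>)"
    by (rule unif_o_zeroI) (simp add: momentum kerr_coeffs_def)
next
  \<comment> \<open>At x = 0 the scaled W, S, A are -3, 1, 1. This is the origin of the coefficient
    -3 m a sin \<theta>, and the summand 3 makes the remainder vanish at infinity.\<close>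
  have 13: "unif_o 2 (\<lambda>r \<theta> \<phi>. (P (pt r \<theta> \<phi>) $ 1 $ 3 - (0 / r + - 3 * m * a * sin \<theta> / r\<^sup>2)) * sin \<theta> / sin \<theta>)"
  proof (rule unif_oI[OF \<delta>_pos, where G = "\<lambda>x \<theta>. m * a * sin \<theta> * (kerr_W (x * a) (1 - x * m) \<theta>
      / (kerr_S (x * a) (1 - x * m) \<theta> * kerr_A (x * m) (x * a) (1 - x * m) \<theta>) + 3)"])
    show "continuous_on ({0..\<delta>} \<times> {0..pi}) (\<lambda>z. m * a * sin (snd z) * (kerr_W (fst z * a) (1 - fst z * m) (snd z)
      / (kerr_S (fst z * a) (1 - fst z * m) (snd z)
         * kerr_A (fst z * m) (fst z * a) (1 - fst z * m) (snd z)) + 3))"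
      by (intro continuous_intros) (auto simp: \<delta>_def less_imp_neq[OF kerr_scaled_pos(1), symmetric]
          less_imp_neq[OF kerr_scaled_pos(3), symmetric])
    show "m * a * sin \<theta> * (kerr_W (0 * a) (1 - 0 * m) \<theta>
      / (kerr_S (0 * a) (1 - 0 * m) \<theta> * kerr_A (0 * m) (0 * a) (1 - 0 * m) \<theta>) + 3) = 0" for \<theta>
      by (simp add: kerr_W_def kerr_S_def kerr_A_def)
    fix x \<theta> \<phi> assume x: "0 < x" "x \<le> \<delta>" "0 < \<theta>" "\<theta> < pi"
    have "kerr_S (x * a) (1 - x * m) \<theta> > 0" "kerr_A (x * m) (x * a) (1 - x * m) \<theta> > 0"
      using x kerr_scaled_pos by (simp_all add: \<delta>_def)
    moreover have "sin \<theta> > 0"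
      using x by (simp add: sin_gt_zero)
    moreover have P: "P (pt (1 / x) \<theta> \<phi>) $ 1 $ 3 = kerr_p m a (1 / x - m) \<theta>"
      using x by (simp add: momentum pt_in_region)
    ultimately show "(P (pt (1 / x) \<theta> \<phi>) $ 1 $ 3 - (0 / (1 / x) + - 3 * m * a * sin \<theta> / (1 / x)\<^sup>2)) * sin \<theta> / sin \<theta>
      = x\<^sup>2 * (m * a * sin \<theta> * (kerr_W (x * a) (1 - x * m) \<theta>
      / (kerr_S (x * a) (1 - x * m) \<theta> * kerr_A (x * m) (x * a) (1 - x * m) \<theta>) + 3))"
      unfolding P kerr_p_def kerr_scale_inverse[OF x(1)]
      using x by (simp add: field_simps eval_nat_numeral)
  qed
  show "unif_o 2 (\<lambda>r \<theta> \<phi>. (P (pt r \<theta> \<phi>) $ 1 $ ang A -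
      (p1_rA (kerr_coeffs m a) A \<theta> \<phi> / r + p2_rA (kerr_coeffs m a) A \<theta> \<phi> / r\<^sup>2)) * frame A \<theta> / sin \<theta>)" for A
  proof (cases "A = 2")
    case True
    then show ?thesis
      using 13 by (simp add: kerr_coeffs_def frame_def)
  next
    case False
    then have "A = 1"
      using exhaust_2 by metis
    then show ?thesis
      by (intro unif_o_zeroI) (simp add: momentum kerr_coeffs_def)
  qed
next
  \<comment> \<open>A general \<open>F\<close> covers both \<theta>\<phi> and \<phi>\<theta>; there
    the frame factor sin \<theta> cancels the density. Since \<open>kerr_q\<close> is of order r^-5,
    two powers of x are left over.\<close>
  have 23: "unif_o 3 F"
    if F: "\<And>r \<theta> \<phi>. pt r \<theta> \<phi> \<in> kerr_region m \<Longrightarrow> F r \<theta> \<phi> = kerr_q m a (r - m) \<theta>" for F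
  proof (rule unif_oI[OF \<delta>_pos, where G = "\<lambda>x \<theta>. x\<^sup>2 * (2 * m * a ^ 3 * (1 - x * m) * (sin \<theta>)\<^sup>2 * cos \<theta>
      / (kerr_S (x * a) (1 - x * m) \<theta> * kerr_A (x * m) (x * a) (1 - x * m) \<theta>))"])
    show "continuous_on ({0..\<delta>} \<times> {0..pi}) (\<lambda>z. (fst z)\<^sup>2 * (2 * m * a ^ 3 * (1 - fst z * m) * (sin (snd z))\<^sup>2
      * cos (snd z) / (kerr_S (fst z * a) (1 - fst z * m) (snd z)
         * kerr_A (fst z * m) (fst z * a) (1 - fst z * m) (snd z))))"
      by (intro continuous_intros) (auto simp: \<delta>_def less_imp_neq[OF kerr_scaled_pos(1), symmetric]
          less_imp_neq[OF kerr_scaled_pos(3), symmetric])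
    fix x \<theta> \<phi> assume x: "0 < x" "x \<le> \<delta>" "0 < \<theta>" "\<theta> < pi"
    have "kerr_S (x * a) (1 - x * m) \<theta> > 0" "kerr_A (x * m) (x * a) (1 - x * m) \<theta> > 0"
      using x kerr_scaled_pos by (simp_all add: \<delta>_def)
    then have "kerr_q m a (1 / x - m) \<theta> =
      x ^ 3 * (x\<^sup>2 * (2 * m * a ^ 3 * (1 - x * m) * (sin \<theta>)\<^sup>2 * cos \<theta>
      / (kerr_S (x * a) (1 - x * m) \<theta> * kerr_A (x * m) (x * a) (1 - x * m) \<theta>)))"
      unfolding kerr_q_def kerr_scale_inverse[OF x(1)]
      using x by (simp add: field_simps eval_nat_numeral)
    then show "F (1 / x) \<theta> \<phi> =
      x ^ 3 * (x\<^sup>2 * (2 * m * a ^ 3 * (1 - x * m) * (sin \<theta>)\<^sup>2 * cos \<theta>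
      / (kerr_S (x * a) (1 - x * m) \<theta> * kerr_A (x * m) (x * a) (1 - x * m) \<theta>)))"
      using x by (simp add: F pt_in_region)
  qed simp
  show "unif_o 3 (\<lambda>r \<theta> \<phi>. (P (pt r \<theta> \<phi>) $ ang A $ ang B -
      (p1_AB (kerr_coeffs m a) A B \<theta> \<phi> / r\<^sup>2 + p2_AB (kerr_coeffs m a) A B \<theta> \<phi> / r ^ 3))
      * (frame A \<theta> * frame B \<theta>) / sin \<theta>)" for A B
  proof (cases "A = B")
    case True
    then show ?thesis
      using exhaust_2[of A] by (intro unif_o_zeroI) (auto simp: momentum kerr_coeffs_def)
  next
    case False
    then have "A = 1 \<and> B = 2 \<or> A = 2 \<and> B = 1"
      using exhaust_2 by metis
    moreover have "sin \<theta> \<noteq> 0" if "pt r \<theta> \<phi> \<in> kerr_region m" for r \<theta> \<phi>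
      using kerr_region_D(2)[OF that] by simp
    ultimately show ?thesis
      by (intro 23) (auto simp: momentum kerr_coeffs_def frame_def)
  qed
qed

text \<open>Parity is immediate: \<lambda>-bar is the constant m, hence even, and every other field
  in the condition is zero. Periodicity holds because no coefficient depends on \<phi>.\<close>

lemma new_boundary_conditions: "new_boundary_conditions (kerr_coeffs m a) g P"
  unfolding new_boundary_conditions_def
  using metric_falloff momentum_falloff constraint_falloff
  by (auto simp: coeffs_on_sphere_def periodic_def parity_conditions_def parity_even_def parity_odd_def
      lambda_bar_def k_bar_def p_bar_def kerr_coeffs_def round_metric_def)

end

lemma kerr_coeffs_vanishing:
  "vanishes_on_sphere (k_bar (kerr_coeffs m a) A B)" "vanishes_on_sphere (p1_rA (kerr_coeffs m a) B)"
  by (simp_all add: vanishes_on_sphere_def k_bar_def lambda_bar_def kerr_coeffs_def)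

lemma schwarzschild_eq_kerr:
  assumes "X $ 2 > 0"
  shows "schwarzschild m X = kerr m 0 X"
proof -
  \<comment> \<open>At r = 2 m both denominators vanish and both quotients are 0 in HOL, so the
    equality needs only r > 0.\<close>
  have "X $ 2 * X $ 2 / (X $ 2 * X $ 2 - 2 * m * X $ 2) = 1 / (1 - 2 * m / X $ 2)"
    using assms by (simp add: divide_simps) (simp add: algebra_simps)
  then show ?thesis
    using assms by (simp add: schwarzschild_def kerr_def Let_def power2_eq_square)
qed

theorem mainTheorem6:
  fixes m a t :: real
  shows
    "(\<exists>c. new_boundary_conditions c
            (transform_metric (old_coords m) (induced_metric (schwarzschild m) t))
            (transform_momentum (old_coords m) (adm_momentum (schwarzschild m) t)) \<and>
          (\<forall>A B. vanishes_on_sphere (k_bar c A B))) \<and>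
     (\<exists>c. new_boundary_conditions c
            (transform_metric (old_coords m) (induced_metric (kerr m a) t))
            (transform_momentum (old_coords m) (adm_momentum (kerr m a) t)) \<and>
          vanishes_on_sphere (p1_rA c 2))"
proof -
  \<comment> \<open>The witnesses for \<open>c\<close> are \<open>kerr_coeffs m 0\<close> and
    \<open>kerr_coeffs m a\<close>.\<close>
  have "kerr_spacetime m 0 (schwarzschild m)" "kerr_spacetime m a (kerr m a)"
    by unfold_locales (simp_all add: schwarzschild_eq_kerr)
  then show ?thesis
    using kerr_spacetime.kerr_slice_old_coords kerr_slice.new_boundary_conditions
      kerr_coeffs_vanishing by blast
qed

end
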